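(* For every integer $n>3$, the blocked-braid group $\mathbf{BB}_n$ is infinite.
   Context: Composition of arrows is written by juxtaposition, $fg$ meaning first $g$, then $f$. A braided strict monoidal category is a category with a strictly associative and unitary tensor functor $\otimes$ with unit $I$, and a natural family of isomorphisms (twist) $\tau_{A,B}:A\otimes B\to B\otimes A$ such that $\tau_{A,B\otimes C}=(1_B\otimes\tau_{A,C})(\tau_{A,B}\otimes 1_C)$ and $\tau_{A\otimes B,C}=(\tau_{A,C}\otimes 1_B)(1_A\otimes\tau_{B,C})$. $A^n$ denotes the $n$-fold tensor power of $A$. A tangle algebra in such a category is an object $A$ with arrows $\eta:I\to A\otimes A$ and $\epsilon:A\otimes A\to I$ satisfying $(\epsilon\otimes 1_A)(1_A\otimes\eta)=1_A=(1_A\otimes\epsilon)(\eta\otimes 1_A)$, $\epsilon\tau_{A,A}=\epsilon$ and $\tau_{A,A}\eta=\eta$. $\mathbf{Tangle}_n$ is the free braided strict monoidal category generated by an object $A$ with a tangle algebra structure and two arrows $R:I\to A^n$ and $S:A^n\to I$ (subject to no further equations). A braid in $\mathbf{Tangle}_n$ is an arrow $B:A^n\to A^n$ that is a composite of arrows each of which is a tensor of identities and arrows $\tau_{A,A}$ or $\tau_{A,A}^{-1}$. A blocked braid on $n$ strings is an arrow $I\to I$ of $\mathbf{Tangle}_n$ of the form $SBR$ with $B$ a braid; equality of blocked braids is equality of arrows in $\mathbf{Tangle}_n$. The blocked-braid group $\mathbf{BB}_n$ has as elements the blocked braids on $n$ strings, identity $S1_{A^n}R$, product $(SBR)(SB'R)=SBB'R$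 and inverse $(SBR)^{-1}=SB^{-1}R$ (these operations are well defined). *)

theory Defs
  imports "HOL-Algebra.Group"
begin

section \<open>Braided strict monoidal categories\<close>

text \<open>
  Composition is written in diagram-reversing order: in \<open>f \<cdot> g\<close> the arrow \<open>g\<close> comes first.
  All operations are total HOL functions; they are only meaningful on the objects, the
  arrows and the composable pairs of arrows.
\<close>

record ('o, 'a) bsm_cat =
  Obj :: "'o set"
  Arr :: "'a set"
  Dom :: "'a \<Rightarrow> 'o"
  Cod :: "'a \<Rightarrow> 'o"
  Ident :: "'o \<Rightarrow> 'a"
  Comp :: "'a \<Rightarrow> 'a \<Rightarrow> 'a"  (infixl "\<cdot>\<index>" 70)
  Unit :: "'o"
  TensO :: "'o \<Rightarrow> 'o \<Rightarrow> 'o"  (infixl "\<boxdot>\<index>" 75)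
  Tens :: "'a \<Rightarrow> 'a \<Rightarrow> 'a"  (infixl "\<boxtimes>\<index>" 75)
  Twist :: "'o \<Rightarrow> 'o \<Rightarrow> 'a"

definition Hom :: "('o, 'a, 'm) bsm_cat_scheme \<Rightarrow> 'o \<Rightarrow> 'o \<Rightarrow> 'a set" where
  "Hom C a b = {f \<in> Arr C. Dom C f = a \<and> Cod C f = b}"

definition inverse_arrows :: "('o, 'a, 'm) bsm_cat_scheme \<Rightarrow> 'a \<Rightarrow> 'a \<Rightarrow> bool" where
  "inverse_arrows C f g \<longleftrightarrow> g \<in> Hom C (Cod C f) (Dom C f) \<and>
     g \<cdot>\<^bsub>C\<^esub> f = Ident C (Dom C f) \<and> f \<cdot>\<^bsub>C\<^esub> g = Ident C (Cod C f)"

definition inv_arrow :: "('o, 'a, 'm) bsm_cat_scheme \<Rightarrow> 'a \<Rightarrow> 'a" where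
  "inv_arrow C f = (THE g. inverse_arrows C f g)"

primrec tens_power :: "('o, 'a, 'm) bsm_cat_scheme \<Rightarrow> 'o \<Rightarrow> nat \<Rightarrow> 'o" where
  "tens_power C A 0 = Unit C"
| "tens_power C A (Suc k) = A \<boxdot>\<^bsub>C\<^esub> tens_power C A k"

locale braided_strict_monoidal_category =
  fixes C :: "('o, 'a, 'm) bsm_cat_scheme" (structure)
  assumes Dom_Obj: "f \<in> Arr C \<Longrightarrow> Dom C f \<in> Obj C"
    and Cod_Obj: "f \<in> Arr C \<Longrightarrow> Cod C f \<in> Obj C"
    and Ident_Hom: "a \<in> Obj C \<Longrightarrow> Ident C a \<in> Hom C a a"
    and Comp_Hom: "\<lbrakk>f \<in> Hom C b c; g \<in> Hom C a b\<rbrakk> \<Longrightarrow> f \<cdot> g \<in> Hom C a c"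
    and Comp_Ident: "f \<in> Hom C a b \<Longrightarrow> f \<cdot> Ident C a = f"
    and Ident_Comp: "f \<in> Hom C a b \<Longrightarrow> Ident C b \<cdot> f = f"
    and Comp_assoc: "\<lbrakk>f \<in> Hom C c d; g \<in> Hom C b c; h \<in> Hom C a b\<rbrakk>
          \<Longrightarrow> (f \<cdot> g) \<cdot> h = f \<cdot> (g \<cdot> h)"
    and Unit_Obj: "Unit C \<in> Obj C"
    and TensO_Obj: "\<lbrakk>a \<in> Obj C; b \<in> Obj C\<rbrakk> \<Longrightarrow> a \<boxdot> b \<in> Obj C"
    and Tens_Hom: "\<lbrakk>f \<in> Hom C a b; g \<in> Hom C c d\<rbrakk> \<Longrightarrow> f \<boxtimes> g \<in> Hom C (a \<boxdot> c) (b \<boxdot> d)"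
    and Tens_Ident: "\<lbrakk>a \<in> Obj C; b \<in> Obj C\<rbrakk> \<Longrightarrow> Ident C a \<boxtimes> Ident C b = Ident C (a \<boxdot> b)"
    and Tens_Comp: "\<lbrakk>f \<in> Hom C b c; h \<in> Hom C a b; g \<in> Hom C b' c'; k \<in> Hom C a' b'\<rbrakk>
          \<Longrightarrow> (f \<boxtimes> g) \<cdot> (h \<boxtimes> k) = (f \<cdot> h) \<boxtimes> (g \<cdot> k)"
    and TensO_assoc: "\<lbrakk>a \<in> Obj C; b \<in> Obj C; c \<in> Obj C\<rbrakk> \<Longrightarrow> (a \<boxdot> b) \<boxdot> c = a \<boxdot> (b \<boxdot> c)"
    and TensO_Unit: "a \<in> Obj C \<Longrightarrow> a \<boxdot> Unit C = a"
    and Unit_TensO: "a \<in> Obj C \<Longrightarrow> Unit C \<boxdot> a = a"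
    and Tens_assoc: "\<lbrakk>f \<in> Arr C; g \<in> Arr C; h \<in> Arr C\<rbrakk> \<Longrightarrow> (f \<boxtimes> g) \<boxtimes> h = f \<boxtimes> (g \<boxtimes> h)"
    and Tens_Unit: "f \<in> Arr C \<Longrightarrow> f \<boxtimes> Ident C (Unit C) = f"
    and Unit_Tens: "f \<in> Arr C \<Longrightarrow> Ident C (Unit C) \<boxtimes> f = f"
    and Twist_Hom: "\<lbrakk>a \<in> Obj C; b \<in> Obj C\<rbrakk> \<Longrightarrow> Twist C a b \<in> Hom C (a \<boxdot> b) (b \<boxdot> a)"
    and Twist_iso: "\<lbrakk>a \<in> Obj C; b \<in> Obj C\<rbrakk> \<Longrightarrow> \<exists>g. inverse_arrows C (Twist C a b) g"
    and Twist_natural: "\<lbrakk>f \<in> Hom C a a'; g \<in> Hom C b b'\<rbrakk>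
          \<Longrightarrow> Twist C a' b' \<cdot> (f \<boxtimes> g) = (g \<boxtimes> f) \<cdot> Twist C a b"
    and Twist_TensO_right: "\<lbrakk>a \<in> Obj C; b \<in> Obj C; c \<in> Obj C\<rbrakk>
          \<Longrightarrow> Twist C a (b \<boxdot> c) = (Ident C b \<boxtimes> Twist C a c) \<cdot> (Twist C a b \<boxtimes> Ident C c)"
    and Twist_TensO_left: "\<lbrakk>a \<in> Obj C; b \<in> Obj C; c \<in> Obj C\<rbrakk>
          \<Longrightarrow> Twist C (a \<boxdot> b) c = (Twist C a c \<boxtimes> Ident C b) \<cdot> (Ident C a \<boxtimes> Twist C b c)"

locale tangle_algebra = braided_strict_monoidal_category C
  for C :: "('o, 'a, 'm) bsm_cat_scheme" (structure) +
  fixes A :: 'o and \<eta> \<epsilon> :: 'a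
  assumes A_Obj: "A \<in> Obj C"
    and eta_Hom: "\<eta> \<in> Hom C (Unit C) (A \<boxdot> A)"
    and eps_Hom: "\<epsilon> \<in> Hom C (A \<boxdot> A) (Unit C)"
    and snake_right: "(\<epsilon> \<boxtimes> Ident C A) \<cdot> (Ident C A \<boxtimes> \<eta>) = Ident C A"
    and snake_left: "(Ident C A \<boxtimes> \<epsilon>) \<cdot> (\<eta> \<boxtimes> Ident C A) = Ident C A"
    and eps_Twist: "\<epsilon> \<cdot> Twist C A A = \<epsilon>"
    and Twist_eta: "Twist C A A \<cdot> \<eta> = \<eta>"

locale tangle_algebra_with_blocks = tangle_algebra C A \<eta> \<epsilon>
  for C :: "('o, 'a, 'm) bsm_cat_scheme" (structure) and A and \<eta> and \<epsilon> +
  fixes n :: nat and R S :: 'a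
  assumes R_Hom: "R \<in> Hom C (Unit C) (tens_power C A n)"
    and S_Hom: "S \<in> Hom C (tens_power C A n) (Unit C)"

text \<open>Functors that preserve the whole structure on the nose, as a pair of maps.\<close>

definition strict_braided_functor ::
  "('o, 'a, 'm) bsm_cat_scheme \<Rightarrow> ('p, 'b, 'k) bsm_cat_scheme \<Rightarrow> ('o \<Rightarrow> 'p) \<Rightarrow> ('a \<Rightarrow> 'b) \<Rightarrow> bool" where
  "strict_braided_functor C D Fo Fa \<longleftrightarrow>
     (\<forall>a\<in>Obj C. Fo a \<in> Obj D) \<and>
     (\<forall>f\<in>Arr C. Fa f \<in> Hom D (Fo (Dom C f)) (Fo (Cod C f))) \<and>
     (\<forall>a\<in>Obj C. Fa (Ident C a) = Ident D (Fo a)) \<and>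
     (\<forall>f\<in>Arr C. \<forall>g\<in>Arr C. Dom C f = Cod C g \<longrightarrow> Fa (f \<cdot>\<^bsub>C\<^esub> g) = Fa f \<cdot>\<^bsub>D\<^esub> Fa g) \<and>
     Fo (Unit C) = Unit D \<and>
     (\<forall>a\<in>Obj C. \<forall>b\<in>Obj C. Fo (a \<boxdot>\<^bsub>C\<^esub> b) = Fo a \<boxdot>\<^bsub>D\<^esub> Fo b) \<and>
     (\<forall>f\<in>Arr C. \<forall>g\<in>Arr C. Fa (f \<boxtimes>\<^bsub>C\<^esub> g) = Fa f \<boxtimes>\<^bsub>D\<^esub> Fa g) \<and>
     (\<forall>a\<in>Obj C. \<forall>b\<in>Obj C. Fa (Twist C a b) = Twist D (Fo a) (Fo b))"


section \<open>The free category on a tangle algebra with two blocks\<close>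

text \<open>
  The objects of \<open>Tangle n\<close> are the powers of the generating object, represented by their
  exponents, so that \<open>A = 1\<close>, \<open>I = 0\<close> and the tensor product of objects is addition. Arrows
  are classes of well-formed terms modulo the congruence generated by exactly the
  equations of a braided strict monoidal category and of a tangle algebra.
  Freeness is proved below (theorems \<open>Tangle_free_existence\<close> and \<open>Tangle_free_uniqueness\<close>).
\<close>

datatype tangle_term =
    TId nat
  | TComp tangle_term tangle_term
  | TTens tangle_term tangle_term
  | TTwist nat nat
  | TTwistInv nat nat
  | TEta
  | TEps
  | TR
  | TS

primrec tdom :: "nat \<Rightarrow> tangle_term \<Rightarrow> nat" where
  "tdom n (TId a) = a"
| "tdom n (TComp f g) = tdom n g"
| "tdom n (TTens f g) = tdom n f + tdom n g"
| "tdom n (TTwist a b) = a + b"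
| "tdom n (TTwistInv a b) = b + a"
| "tdom n TEta = 0"
| "tdom n TEps = 2"
| "tdom n TR = 0"
| "tdom n TS = n"

primrec tcod :: "nat \<Rightarrow> tangle_term \<Rightarrow> nat" where
  "tcod n (TId a) = a"
| "tcod n (TComp f g) = tcod n f"
| "tcod n (TTens f g) = tcod n f + tcod n g"
| "tcod n (TTwist a b) = b + a"
| "tcod n (TTwistInv a b) = a + b"
| "tcod n TEta = 2"
| "tcod n TEps = 0"
| "tcod n TR = n"
| "tcod n TS = 0"

primrec twf :: "nat \<Rightarrow> tangle_term \<Rightarrow> bool" where
  "twf n (TId a) \<longleftrightarrow> True"
| "twf n (TComp f g) \<longleftrightarrow> twf n f \<and> twf n g \<and> tdom n f = tcod n g"
| "twf n (TTens f g) \<longleftrightarrow> twf n f \<and> twf n g"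
| "twf n (TTwist a b) \<longleftrightarrow> True"
| "twf n (TTwistInv a b) \<longleftrightarrow> True"
| "twf n TEta \<longleftrightarrow> True"
| "twf n TEps \<longleftrightarrow> True"
| "twf n TR \<longleftrightarrow> True"
| "twf n TS \<longleftrightarrow> True"

inductive teq :: "nat \<Rightarrow> tangle_term \<Rightarrow> tangle_term \<Rightarrow> bool" for n :: nat where
  refl: "twf n f \<Longrightarrow> teq n f f"
| sym: "teq n f g \<Longrightarrow> teq n g f"
| trans: "\<lbrakk>teq n f g; teq n g h\<rbrakk> \<Longrightarrow> teq n f h"
| comp_cong: "\<lbrakk>teq n f f'; teq n g g'; tdom n f = tcod n g\<rbrakk> \<Longrightarrow> teq n (TComp f g) (TComp f' g')"
| tens_cong: "\<lbrakk>teq n f f'; teq n g g'\<rbrakk> \<Longrightarrow> teq n (TTens f g) (TTens f' g')"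
| comp_id: "twf n f \<Longrightarrow> teq n (TComp f (TId (tdom n f))) f"
| id_comp: "twf n f \<Longrightarrow> teq n (TComp (TId (tcod n f)) f) f"
| comp_assoc: "\<lbrakk>twf n f; twf n g; twf n h; tdom n f = tcod n g; tdom n g = tcod n h\<rbrakk>
    \<Longrightarrow> teq n (TComp (TComp f g) h) (TComp f (TComp g h))"
| tens_id: "teq n (TTens (TId a) (TId b)) (TId (a + b))"
| tens_comp: "\<lbrakk>twf n f; twf n g; twf n h; twf n k; tdom n f = tcod n h; tdom n g = tcod n k\<rbrakk>
    \<Longrightarrow> teq n (TComp (TTens f g) (TTens h k)) (TTens (TComp f h) (TComp g k))"
| tens_assoc: "\<lbrakk>twf n f; twf n g; twf n h\<rbrakk>
    \<Longrightarrow> teq n (TTens (TTens f g) h) (TTens f (TTens g h))"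
| tens_unit: "twf n f \<Longrightarrow> teq n (TTens f (TId 0)) f"
| unit_tens: "twf n f \<Longrightarrow> teq n (TTens (TId 0) f) f"
| twist_inv_left: "teq n (TComp (TTwistInv a b) (TTwist a b)) (TId (a + b))"
| twist_inv_right: "teq n (TComp (TTwist a b) (TTwistInv a b)) (TId (b + a))"
| twist_natural: "\<lbrakk>twf n f; twf n g\<rbrakk>
    \<Longrightarrow> teq n (TComp (TTwist (tcod n f) (tcod n g)) (TTens f g))
              (TComp (TTens g f) (TTwist (tdom n f) (tdom n g)))"
| twist_tens_right: "teq n (TTwist a (b + c))
    (TComp (TTens (TId b) (TTwist a c)) (TTens (TTwist a b) (TId c)))"
| twist_tens_left: "teq n (TTwist (a + b) c)
    (TComp (TTens (TTwist a c) (TId b)) (TTens (TId a) (TTwist b c)))"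
| zigzag_right: "teq n (TComp (TTens TEps (TId 1)) (TTens (TId 1) TEta)) (TId 1)"
| zigzag_left: "teq n (TComp (TTens (TId 1) TEps) (TTens TEta (TId 1))) (TId 1)"
| eps_twist: "teq n (TComp TEps (TTwist 1 1)) TEps"
| twist_eta: "teq n (TComp (TTwist 1 1) TEta) TEta"

definition tclass :: "nat \<Rightarrow> tangle_term \<Rightarrow> tangle_term set" where
  "tclass n f = {g. teq n f g}"

definition trep :: "tangle_term set \<Rightarrow> tangle_term" where
  "trep X = (SOME f. f \<in> X)"

definition Tangle :: "nat \<Rightarrow> (nat, tangle_term set) bsm_cat" where
  "Tangle n = \<lparr>
     Obj = UNIV,
     Arr = {tclass n f | f. twf n f},
     Dom = (\<lambda>X. tdom n (trep X)),
     Cod = (\<lambda>X. tcod n (trep X)),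
     Ident = (\<lambda>a. tclass n (TId a)),
     Comp = (\<lambda>X Y. tclass n (TComp (trep X) (trep Y))),
     Unit = 0,
     TensO = (+),
     Tens = (\<lambda>X Y. tclass n (TTens (trep X) (trep Y))),
     Twist = (\<lambda>a b. tclass n (TTwist a b))\<rparr>"

abbreviation Tangle_A :: nat where "Tangle_A \<equiv> 1"
definition Tangle_eta :: "nat \<Rightarrow> tangle_term set" where "Tangle_eta n = tclass n TEta"
definition Tangle_eps :: "nat \<Rightarrow> tangle_term set" where "Tangle_eps n = tclass n TEps"
definition Tangle_R :: "nat \<Rightarrow> tangle_term set" where "Tangle_R n = tclass n TR"
definition Tangle_S :: "nat \<Rightarrow> tangle_term set" where "Tangle_S n = tclass n TS"


section \<open>Braids and blocked braids\<close>

inductive_set braid_layer :: "('o, 'a, 'm) bsm_cat_scheme \<Rightarrow> 'o \<Rightarrow> 'a set"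
  for C :: "('o, 'a, 'm) bsm_cat_scheme" and A :: 'o where
  ident: "a \<in> Obj C \<Longrightarrow> Ident C a \<in> braid_layer C A"
| twist: "Twist C A A \<in> braid_layer C A"
| twist_inv: "inv_arrow C (Twist C A A) \<in> braid_layer C A"
| tens: "\<lbrakk>f \<in> braid_layer C A; g \<in> braid_layer C A\<rbrakk> \<Longrightarrow> f \<boxtimes>\<^bsub>C\<^esub> g \<in> braid_layer C A"

inductive_set braid_composite :: "('o, 'a, 'm) bsm_cat_scheme \<Rightarrow> 'o \<Rightarrow> 'a set"
  for C :: "('o, 'a, 'm) bsm_cat_scheme" and A :: 'o where
  layer: "f \<in> braid_layer C A \<Longrightarrow> f \<in> braid_composite C A"
| comp: "\<lbrakk>f \<in> braid_composite C A; g \<in> braid_composite C A; Dom C f = Cod C g\<rbrakk>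
    \<Longrightarrow> f \<cdot>\<^bsub>C\<^esub> g \<in> braid_composite C A"

definition braids :: "('o, 'a, 'm) bsm_cat_scheme \<Rightarrow> 'o \<Rightarrow> nat \<Rightarrow> 'a set" where
  "braids C A n = braid_composite C A \<inter> Hom C (tens_power C A n) (tens_power C A n)"

definition blocked :: "nat \<Rightarrow> tangle_term set \<Rightarrow> tangle_term set" where
  "blocked n B = Tangle_S n \<cdot>\<^bsub>Tangle n\<^esub> B \<cdot>\<^bsub>Tangle n\<^esub> Tangle_R n"

definition tangle_braids :: "nat \<Rightarrow> tangle_term set set" where
  "tangle_braids n = braids (Tangle n) Tangle_A n"

text \<open>
  The product is defined on arrows, through representing braids; independence of the
  representatives is proved in \<open>BB_mult\<close>, and the formula for inverses in \<open>BB_inv\<close>.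
\<close>

definition BB :: "nat \<Rightarrow> tangle_term set monoid" where
  "BB n = \<lparr>
     carrier = blocked n ` tangle_braids n,
     mult = (\<lambda>x y. THE z. \<exists>B\<in>tangle_braids n. \<exists>B'\<in>tangle_braids n.
               x = blocked n B \<and> y = blocked n B' \<and> z = blocked n (B \<cdot>\<^bsub>Tangle n\<^esub> B')),
     one = blocked n (Ident (Tangle n) (tens_power (Tangle n) Tangle_A n))\<rparr>"


section \<open>Adequacy of the construction\<close>

lemma teq_typed:
  "teq n f g \<Longrightarrow> twf n f \<and> twf n g \<and> tdom n f = tdom n g \<and> tcod n f = tcod n g"
  by (induction rule: teq.induct) auto

lemma tclass_eq: "twf n f \<Longrightarrow> tclass n f = tclass n g \<longleftrightarrow> teq n f g"
  unfolding tclass_def by (auto intro: teq.refl teq.sym teq.trans)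

lemma tclassI: "teq n f g \<Longrightarrow> tclass n f = tclass n g"
  using tclass_eq teq_typed by blast

lemma trep_tclass: "twf n f \<Longrightarrow> teq n f (trep (tclass n f))"
  unfolding trep_def tclass_def by (auto intro: someI teq.refl)

lemma tclass_trep: "X \<in> Arr (Tangle n) \<Longrightarrow> tclass n (trep X) = X \<and> twf n (trep X)"
  unfolding Tangle_def using trep_tclass tclass_eq teq_typed by fastforce

lemma tclass_Arr: "twf n f \<Longrightarrow> tclass n f \<in> Arr (Tangle n)"
  by (auto simp: Tangle_def)

lemma tclass_Dom: "twf n f \<Longrightarrow> Dom (Tangle n) (tclass n f) = tdom n f"
  using trep_tclass teq_typed by (fastforce simp: Tangle_def)

lemma tclass_Cod: "twf n f \<Longrightarrow> Cod (Tangle n) (tclass n f) = tcod n f"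
  using trep_tclass teq_typed by (fastforce simp: Tangle_def)

lemma tclass_Comp:
  assumes "twf n f" "twf n g" "tdom n f = tcod n g"
  shows "tclass n f \<cdot>\<^bsub>Tangle n\<^esub> tclass n g = tclass n (TComp f g)"
proof -
  have "teq n (TComp f g) (TComp (trep (tclass n f)) (trep (tclass n g)))"
    using assms by (intro teq.comp_cong trep_tclass)
  from tclassI[OF this] show ?thesis by (simp add: Tangle_def)
qed

lemma tclass_Tens:
  assumes "twf n f" "twf n g"
  shows "tclass n f \<boxtimes>\<^bsub>Tangle n\<^esub> tclass n g = tclass n (TTens f g)"
proof -
  have "teq n (TTens f g) (TTens (trep (tclass n f)) (trep (tclass n g)))"
    using assms by (intro teq.tens_cong trep_tclass)
  from tclassI[OF this] show ?thesis by (simp add: Tangle_def)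
qed

lemma Tangle_simps [simp]:
  "Obj (Tangle n) = UNIV" "Unit (Tangle n) = 0" "TensO (Tangle n) = (+)"
  "Ident (Tangle n) a = tclass n (TId a)" "Twist (Tangle n) a b = tclass n (TTwist a b)"
  by (simp_all add: Tangle_def)

lemma tens_power_Tangle [simp]: "tens_power (Tangle n) Tangle_A k = k"
  by (induction k) auto

lemma Hom_Tangle_iff:
  "X \<in> Hom (Tangle n) a b \<longleftrightarrow> (\<exists>f. twf n f \<and> tdom n f = a \<and> tcod n f = b \<and> X = tclass n f)"
proof
  assume "X \<in> Hom (Tangle n) a b"
  hence X: "X \<in> Arr (Tangle n)" "Dom (Tangle n) X = a" "Cod (Tangle n) X = b"
    by (auto simp: Hom_def)
  thus "\<exists>f. twf n f \<and> tdom n f = a \<and> tcod n f = b \<and> X = tclass n f"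
    using tclass_trep[OF X(1)] by (intro exI[of _ "trep X"]) (auto simp: Tangle_def)
qed (auto simp: Hom_def tclass_Arr tclass_Dom tclass_Cod)

lemma Hom_TangleE:
  assumes "X \<in> Hom (Tangle n) a b"
  obtains f where "twf n f" "tdom n f = a" "tcod n f = b" "X = tclass n f"
  using assms Hom_Tangle_iff by blast

lemma Arr_TangleE:
  assumes "X \<in> Arr (Tangle n)"
  obtains f where "twf n f" "X = tclass n f"
  using tclass_trep[OF assms] by metis

lemma tclass_Hom: "\<lbrakk>twf n f; tdom n f = a; tcod n f = b\<rbrakk> \<Longrightarrow> tclass n f \<in> Hom (Tangle n) a b"
  using Hom_Tangle_iff by blast

lemmas tclass_ops = tclass_Comp tclass_Tens

lemma inverse_TTwist:
  "inverse_arrows (Tangle n) (tclass n (TTwist a b)) (tclass n (TTwistInv a b))"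
  unfolding inverse_arrows_def
  by (auto simp: tclass_Dom tclass_Cod tclass_ops tclass_eq intro!: tclass_Hom teq.intros)

theorem Tangle_category: "braided_strict_monoidal_category (Tangle n)"
proof (unfold_locales, goal_cases)
  case (16 f g h) thus ?case
    by (elim Arr_TangleE) (simp add: tclass_ops, intro tclassI teq.tens_assoc)
next
  case (17 f) thus ?case
    by (elim Arr_TangleE) (simp add: tclass_ops, intro tclassI teq.tens_unit)
next
  case (18 f) thus ?case
    by (elim Arr_TangleE) (simp add: tclass_ops, intro tclassI teq.unit_tens)
next
  case (20 a b) thus ?case using inverse_TTwist by auto
next
  case (21 f a a' g b b') thus ?case
    by (elim Hom_TangleE) (simp add: tclass_ops, metis tclassI teq.twist_natural)
qed (auto elim!: Hom_TangleE simp: tclass_ops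
      intro!: tclass_Hom tclassI teq.intros(6-) del: subset_antisym)


lemma (in braided_strict_monoidal_category) inv_arrow_eq:
  assumes "inverse_arrows C f g" "f \<in> Arr C"
  shows "inv_arrow C f = g"
  unfolding inv_arrow_def
proof (rule the_equality)
  fix h assume h: "inverse_arrows C f h"
  let ?a = "Dom C f" and ?b = "Cod C f"
  have f: "f \<in> Hom C ?a ?b" using assms(2) by (simp add: Hom_def)
  have g: "g \<in> Hom C ?b ?a" "g \<cdot> f = Ident C ?a" "f \<cdot> g = Ident C ?b"
    and h': "h \<in> Hom C ?b ?a" "h \<cdot> f = Ident C ?a"
    using assms(1) h by (auto simp: inverse_arrows_def)
  have "h = h \<cdot> (f \<cdot> g)" using Comp_Ident[OF h'(1)] g(3) by simp
  also have "\<dots> = (h \<cdot> f) \<cdot> g" using Comp_assoc[OF h'(1) f g(1)] by simp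
  also have "\<dots> = g" using h'(2) Ident_Comp[OF g(1)] by simp
  finally show "h = g" .
qed (fact assms(1))

lemma (in braided_strict_monoidal_category) inverse_inv_arrow:
  "\<lbrakk>inverse_arrows C f g; f \<in> Arr C\<rbrakk> \<Longrightarrow> inverse_arrows C f (inv_arrow C f)"
  using inv_arrow_eq by metis

theorem Tangle_generators:
  "tangle_algebra_with_blocks (Tangle n) Tangle_A (Tangle_eta n) (Tangle_eps n) n
     (Tangle_R n) (Tangle_S n)"
proof -
  interpret braided_strict_monoidal_category "Tangle n" by (rule Tangle_category)
  show ?thesis
    by unfold_locales
      (auto simp: Tangle_eta_def Tangle_eps_def Tangle_R_def Tangle_S_def tclass_ops
         simp del: One_nat_def
         intro!: tclass_Hom tclassI teq.zigzag_left teq.zigzag_right teq.eps_twist teq.twist_eta)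
qed

context tangle_algebra_with_blocks
begin

definition interprets :: "(nat \<Rightarrow> 'o) \<Rightarrow> (tangle_term set \<Rightarrow> 'a) \<Rightarrow> bool" where
  "interprets Fo Fa \<longleftrightarrow> strict_braided_functor (Tangle n) C Fo Fa \<and> Fo Tangle_A = A \<and>
     Fa (Tangle_eta n) = \<eta> \<and> Fa (Tangle_eps n) = \<epsilon> \<and> Fa (Tangle_R n) = R \<and> Fa (Tangle_S n) = S"

abbreviation pw :: "nat \<Rightarrow> 'o" where "pw \<equiv> tens_power C A"

lemma pw_Obj: "pw k \<in> Obj C"
  by (induction k) (auto simp: Unit_Obj TensO_Obj A_Obj)

lemma pw_add: "pw (k + m) = pw k \<boxdot> pw m"
  by (induction k) (auto simp: Unit_TensO TensO_assoc A_Obj pw_Obj)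

lemma pw_1: "pw 1 = A" and pw_2: "pw 2 = A \<boxdot> A"
  by (simp_all add: numeral_2_eq_2 TensO_Unit A_Obj)

primrec tval :: "tangle_term \<Rightarrow> 'a" where
  "tval (TId a) = Ident C (pw a)"
| "tval (TComp f g) = tval f \<cdot> tval g"
| "tval (TTens f g) = tval f \<boxtimes> tval g"
| "tval (TTwist a b) = Twist C (pw a) (pw b)"
| "tval (TTwistInv a b) = inv_arrow C (Twist C (pw a) (pw b))"
| "tval TEta = \<eta>"
| "tval TEps = \<epsilon>"
| "tval TR = R"
| "tval TS = S"

lemma inverse_Twist:
  assumes "a \<in> Obj C" "b \<in> Obj C"
  shows "inv_arrow C (Twist C a b) \<in> Hom C (b \<boxdot> a) (a \<boxdot> b)"
    "inv_arrow C (Twist C a b) \<cdot> Twist C a b = Ident C (a \<boxdot> b)"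
    "Twist C a b \<cdot> inv_arrow C (Twist C a b) = Ident C (b \<boxdot> a)"
proof -
  have t: "Twist C a b \<in> Hom C (a \<boxdot> b) (b \<boxdot> a)" using Twist_Hom assms by blast
  with Twist_iso[OF assms] inverse_inv_arrow
  have "inverse_arrows C (Twist C a b) (inv_arrow C (Twist C a b))"
    by (auto simp: Hom_def)
  with t show "inv_arrow C (Twist C a b) \<in> Hom C (b \<boxdot> a) (a \<boxdot> b)"
    "inv_arrow C (Twist C a b) \<cdot> Twist C a b = Ident C (a \<boxdot> b)"
    "Twist C a b \<cdot> inv_arrow C (Twist C a b) = Ident C (b \<boxdot> a)"
    by (auto simp: inverse_arrows_def Hom_def)
qed

lemma tval_Hom: "twf n f \<Longrightarrow> tval f \<in> Hom C (pw (tdom n f)) (pw (tcod n f))"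
proof (induction f)
  case (TComp f g) thus ?case by (auto intro: Comp_Hom)
qed (auto simp: pw_add pw_2 pw_Obj
      intro: Ident_Hom Tens_Hom Twist_Hom inverse_Twist eta_Hom eps_Hom R_Hom S_Hom)

lemma tval_Arr: "twf n f \<Longrightarrow> tval f \<in> Arr C"
  using tval_Hom by (auto simp: Hom_def)

lemma tval_teq: "teq n f g \<Longrightarrow> tval f = tval g"
proof (induction rule: teq.induct)
  case (comp_assoc f g h)
  thus ?case using tval_Hom[of f] tval_Hom[of g] tval_Hom[of h] by (simp add: Comp_assoc)
next
  case (tens_comp f g h k)
  thus ?case using tval_Hom[of f] tval_Hom[of g] tval_Hom[of h] tval_Hom[of k]
    by (simp add: Tens_Comp)
next
  case (comp_id f) thus ?case using Comp_Ident[OF tval_Hom] by simp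
next
  case (id_comp f) thus ?case using Ident_Comp[OF tval_Hom] by simp
next
  case (twist_natural f g)
  thus ?case using tval_Hom[of f] tval_Hom[of g] by (simp add: Twist_natural)
next
  case zigzag_right
  show ?case using snake_right by (simp add: TensO_Unit A_Obj)
next
  case zigzag_left
  show ?case using snake_left by (simp add: TensO_Unit A_Obj)
next
  case eps_twist
  show ?case using eps_Twist by (simp add: TensO_Unit A_Obj)
next
  case twist_eta
  show ?case using Twist_eta by (simp add: TensO_Unit A_Obj)
qed (auto simp: pw_add pw_Obj tval_Arr Tens_assoc Tens_Unit Unit_Tens Tens_Ident inverse_Twist
      Twist_TensO_left Twist_TensO_right)

theorem Tangle_free_existence: "\<exists>Fo Fa. interprets Fo Fa"
proof (intro exI)
  let ?F = "\<lambda>X. tval (trep X)"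
  have F: "?F (tclass n f) = tval f" if "twf n f" for f
    using tval_teq[OF trep_tclass[OF that]] by simp
  have H: "?F X \<in> Hom C (pw (Dom (Tangle n) X)) (pw (Cod (Tangle n) X))"
    if "X \<in> Arr (Tangle n)" for X
    using that by (auto elim!: Arr_TangleE simp: F tclass_Dom tclass_Cod tval_Hom)
  have comp: "?F (X \<cdot>\<^bsub>Tangle n\<^esub> Y) = ?F X \<cdot> ?F Y"
    if "X \<in> Arr (Tangle n)" "Y \<in> Arr (Tangle n)" "Dom (Tangle n) X = Cod (Tangle n) Y" for X Y
    using that by (auto elim!: Arr_TangleE simp: F tclass_Dom tclass_Cod tclass_ops)
  have tens: "?F (X \<boxtimes>\<^bsub>Tangle n\<^esub> Y) = ?F X \<boxtimes> ?F Y"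
    if "X \<in> Arr (Tangle n)" "Y \<in> Arr (Tangle n)" for X Y
    using that by (auto elim!: Arr_TangleE simp: F tclass_ops)
  show "interprets pw ?F"
    unfolding interprets_def strict_braided_functor_def
    using H comp tens pw_1
    by (simp add: F pw_Obj pw_add Tangle_eta_def Tangle_eps_def Tangle_R_def Tangle_S_def)
qed

theorem Tangle_free_uniqueness:
  assumes "interprets Fo Fa" "interprets Go Ga"
  shows "Fo = Go" "\<And>X. X \<in> Arr (Tangle n) \<Longrightarrow> Fa X = Ga X"
proof -
  have F: "Fo = pw \<and> (\<forall>f. twf n f \<longrightarrow> Fa (tclass n f) = tval f)" if "interprets Fo Fa" for Fo Fa
  proof -
    have sf: "strict_braided_functor (Tangle n) C Fo Fa" and 1: "Fo 1 = A"
      using that by (auto simp: interprets_def)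
    have add: "Fo (a + b) = Fo a \<boxdot> Fo b" and zero: "Fo 0 = Unit C"
      and tw: "Fa (tclass n (TTwist a b)) = Twist C (Fo a) (Fo b)"
      and idn: "Fa (tclass n (TId a)) = Ident C (Fo a)" for a b
      using sf by (simp_all add: strict_braided_functor_def)
    have hom: "Fa X \<in> Hom C (Fo (Dom (Tangle n) X)) (Fo (Cod (Tangle n) X))"
      if "X \<in> Arr (Tangle n)" for X
      using sf that by (simp add: strict_braided_functor_def)
    have comp: "Fa (X \<cdot>\<^bsub>Tangle n\<^esub> Y) = Fa X \<cdot> Fa Y"
      if "X \<in> Arr (Tangle n)" "Y \<in> Arr (Tangle n)" "Dom (Tangle n) X = Cod (Tangle n) Y" for X Y
      using sf that by (simp add: strict_braided_functor_def)
    have tens: "Fa (X \<boxtimes>\<^bsub>Tangle n\<^esub> Y) = Fa X \<boxtimes> Fa Y"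
      if "X \<in> Arr (Tangle n)" "Y \<in> Arr (Tangle n)" for X Y
      using sf that by (simp add: strict_braided_functor_def)
    have o: "Fo k = pw k" for k
    proof (induction k)
      case (Suc k) thus ?case using add[of 1 k] 1 by simp
    qed (simp add: zero)
    have "Fa (tclass n f) = tval f" if "twf n f" for f
      using that
    proof (induction f)
      case (TComp f g)
      thus ?case using comp[of "tclass n f" "tclass n g"]
        by (simp add: tclass_Arr tclass_Dom tclass_Cod tclass_ops)
    next
      case (TTens f g)
      thus ?case using tens[of "tclass n f" "tclass n g"] by (simp add: tclass_Arr tclass_ops)
    next
      case (TTwistInv a b)
      let ?t = "tclass n (TTwist a b)" and ?i = "tclass n (TTwistInv a b)"
      have t: "Twist C (pw a) (pw b) \<in> Hom C (pw a \<boxdot> pw b) (pw b \<boxdot> pw a)"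
        using Twist_Hom pw_Obj by blast
      have "?i \<cdot>\<^bsub>Tangle n\<^esub> ?t = tclass n (TId (a + b))" "?t \<cdot>\<^bsub>Tangle n\<^esub> ?i = tclass n (TId (b + a))"
        by (auto simp: tclass_ops intro!: tclassI teq.intros)
      hence "inverse_arrows C (Twist C (pw a) (pw b)) (Fa ?i)"
        using comp[of ?i ?t] comp[of ?t ?i] hom[of ?i] t
        by (simp add: tclass_Arr tclass_Dom tclass_Cod tw idn o pw_add inverse_arrows_def Hom_def)
      thus ?case using inv_arrow_eq t by (simp add: Hom_def)
    qed (use that \<open>interprets Fo Fa\<close> in
          \<open>simp_all add: idn tw o interprets_def Tangle_eta_def Tangle_eps_def Tangle_R_def Tangle_S_def\<close>)
    with o show ?thesis by auto
  qed
  show "Fo = Go" using F[OF assms(1)] F[OF assms(2)] by simp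
  fix X assume "X \<in> Arr (Tangle n)"
  thus "Fa X = Ga X" using F[OF assms(1)] F[OF assms(2)] by (auto elim!: Arr_TangleE)
qed

end


subsection \<open>The group structure on blocked braids\<close>

context
  fixes n :: nat
  notes One_nat_def [simp del]
begin

interpretation T: tangle_algebra_with_blocks "Tangle n" Tangle_A "Tangle_eta n" "Tangle_eps n" n
  "Tangle_R n" "Tangle_S n"
  by (rule Tangle_generators)

lemma inv_TTwist: "inv_arrow (Tangle n) (tclass n (TTwist a b)) = tclass n (TTwistInv a b)"
  by (intro T.inv_arrow_eq inverse_TTwist tclass_Arr) simp

lemma inverse_arrows_iff:
  "f \<in> Hom (Tangle n) a b \<Longrightarrow> inverse_arrows (Tangle n) f g \<longleftrightarrow> g \<in> Hom (Tangle n) b a \<and>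
     g \<cdot>\<^bsub>Tangle n\<^esub> f = Ident (Tangle n) a \<and> f \<cdot>\<^bsub>Tangle n\<^esub> g = Ident (Tangle n) b"
  by (auto simp: inverse_arrows_def Hom_def)

lemma Hom_self: "f \<in> Arr (Tangle n) \<Longrightarrow> f \<in> Hom (Tangle n) (Dom (Tangle n) f) (Cod (Tangle n) f)"
  by (simp add: Hom_def)

lemma layer_inverse:
  "f \<in> braid_layer (Tangle n) Tangle_A \<Longrightarrow>
     f \<in> Arr (Tangle n) \<and> (\<exists>g\<in>braid_layer (Tangle n) Tangle_A. inverse_arrows (Tangle n) f g)"
proof (induction rule: braid_layer.induct)
  case (ident a)
  have "inverse_arrows (Tangle n) (tclass n (TId a)) (tclass n (TId a))"
    by (auto simp: inverse_arrows_def tclass_Dom tclass_Cod tclass_ops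
        intro!: tclassI tclass_Hom teq.comp_id[where f = "TId a", simplified])
  thus ?case using braid_layer.ident[of a "Tangle n"] by (auto intro: tclass_Arr)
next
  case twist
  show ?case using inverse_TTwist[of n 1 1] braid_layer.twist_inv[of "Tangle n" Tangle_A]
    by (auto simp: inv_TTwist intro: tclass_Arr)
next
  case twist_inv
  have "inverse_arrows (Tangle n) (tclass n (TTwistInv 1 1)) (tclass n (TTwist 1 1))"
    using inverse_TTwist[of n 1 1] by (simp add: inverse_arrows_def tclass_Dom tclass_Cod tclass_Hom)
  thus ?case using braid_layer.twist[of "Tangle n" Tangle_A]
    by (auto simp: inv_TTwist intro: tclass_Arr)
next
  case (tens f g)
  then obtain f' g' where *: "f \<in> Arr (Tangle n)" "g \<in> Arr (Tangle n)"
    "f' \<in> braid_layer (Tangle n) Tangle_A" "inverse_arrows (Tangle n) f f'"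
    "g' \<in> braid_layer (Tangle n) Tangle_A" "inverse_arrows (Tangle n) g g'" by blast
  note hf = Hom_self[OF *(1)] and hg = Hom_self[OF *(2)]
  note if' = *(4)[unfolded inverse_arrows_iff[OF hf]] and ig' = *(6)[unfolded inverse_arrows_iff[OF hg]]
  have "inverse_arrows (Tangle n) (f \<boxtimes>\<^bsub>Tangle n\<^esub> g) (f' \<boxtimes>\<^bsub>Tangle n\<^esub> g')"
    unfolding inverse_arrows_iff[OF T.Tens_Hom[OF hf hg]]
    using T.Tens_Comp[of f' _ _ f _ g' _ _ g] T.Tens_Comp[of f _ _ f' _ g _ _ g'] if' ig' hf hg
      T.Tens_Ident T.Tens_Hom by (metis Tangle_simps(1) UNIV_I)
  thus ?case using T.Tens_Hom[OF hf hg] braid_layer.tens[OF *(3) *(5)] by (auto simp: Hom_def)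
qed

lemma composite_inverse:
  "f \<in> braid_composite (Tangle n) Tangle_A \<Longrightarrow>
     f \<in> Arr (Tangle n) \<and> (\<exists>g\<in>braid_composite (Tangle n) Tangle_A. inverse_arrows (Tangle n) f g)"
proof (induction rule: braid_composite.induct)
  case (layer f)
  from layer_inverse[OF this] show ?case by (auto intro: braid_composite.layer)
next
  case (comp f g)
  then obtain f' g' where *: "f \<in> Arr (Tangle n)" "g \<in> Arr (Tangle n)"
    "f' \<in> braid_composite (Tangle n) Tangle_A" "inverse_arrows (Tangle n) f f'"
    "g' \<in> braid_composite (Tangle n) Tangle_A" "inverse_arrows (Tangle n) g g'" by blast
  note hf = Hom_self[OF *(1), unfolded comp.hyps] and hg = Hom_self[OF *(2)]
  note if' = *(4)[unfolded inverse_arrows_iff[OF hf]] and ig' = *(6)[unfolded inverse_arrows_iff[OF hg]]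
  note c = if'[THEN conjunct1] ig'[THEN conjunct1]
  have "(g' \<cdot>\<^bsub>Tangle n\<^esub> f') \<cdot>\<^bsub>Tangle n\<^esub> (f \<cdot>\<^bsub>Tangle n\<^esub> g)
      = g' \<cdot>\<^bsub>Tangle n\<^esub> ((f' \<cdot>\<^bsub>Tangle n\<^esub> f) \<cdot>\<^bsub>Tangle n\<^esub> g)"
    using T.Comp_assoc[OF c(2) c(1) T.Comp_Hom[OF hf hg]] T.Comp_assoc[OF c(1) hf hg] by simp
  also have "\<dots> = Ident (Tangle n) (Dom (Tangle n) g)"
    using if' ig' T.Ident_Comp[OF hg] by (simp del: Tangle_simps)
  finally have 1: "(g' \<cdot>\<^bsub>Tangle n\<^esub> f') \<cdot>\<^bsub>Tangle n\<^esub> (f \<cdot>\<^bsub>Tangle n\<^esub> g) = \<dots>" .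
  have "(f \<cdot>\<^bsub>Tangle n\<^esub> g) \<cdot>\<^bsub>Tangle n\<^esub> (g' \<cdot>\<^bsub>Tangle n\<^esub> f')
      = f \<cdot>\<^bsub>Tangle n\<^esub> ((g \<cdot>\<^bsub>Tangle n\<^esub> g') \<cdot>\<^bsub>Tangle n\<^esub> f')"
    using T.Comp_assoc[OF hf hg T.Comp_Hom[OF c(2) c(1)]] T.Comp_assoc[OF hg c(2) c(1)] by simp
  also have "\<dots> = Ident (Tangle n) (Cod (Tangle n) f)"
    using if' ig' T.Ident_Comp[OF c(1)] by (simp del: Tangle_simps)
  finally have 2: "(f \<cdot>\<^bsub>Tangle n\<^esub> g) \<cdot>\<^bsub>Tangle n\<^esub> (g' \<cdot>\<^bsub>Tangle n\<^esub> f') = \<dots>" .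
  have "inverse_arrows (Tangle n) (f \<cdot>\<^bsub>Tangle n\<^esub> g) (g' \<cdot>\<^bsub>Tangle n\<^esub> f')"
    unfolding inverse_arrows_iff[OF T.Comp_Hom[OF hf hg]]
    using 1 2 T.Comp_Hom[OF c(2) c(1)] by blast
  moreover have "Dom (Tangle n) g' = Cod (Tangle n) f'" using c by (simp add: Hom_def)
  ultimately show ?case
    using T.Comp_Hom[OF hf hg] braid_composite.comp[OF *(5) *(3)] by (auto simp: Hom_def)
qed

lemma tangle_braids_iff:
  "B \<in> tangle_braids n \<longleftrightarrow> B \<in> braid_composite (Tangle n) Tangle_A \<and> B \<in> Hom (Tangle n) n n"
  using tens_power_Tangle by (simp add: tangle_braids_def braids_def)

lemma braid_Hom: "B \<in> tangle_braids n \<Longrightarrow> B \<in> Hom (Tangle n) n n"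
  by (simp add: tangle_braids_iff)

lemma braid_id: "Ident (Tangle n) n \<in> tangle_braids n"
  unfolding tangle_braids_iff
  by (simp only: T.Ident_Hom braid_layer.ident braid_composite.layer Tangle_simps(1) UNIV_I simp_thms)

lemma braid_comp:
  "\<lbrakk>B \<in> tangle_braids n; B' \<in> tangle_braids n\<rbrakk> \<Longrightarrow> B \<cdot>\<^bsub>Tangle n\<^esub> B' \<in> tangle_braids n"
  unfolding tangle_braids_iff
  using T.Comp_Hom[of B n n B' n] braid_composite.comp[of B "Tangle n" Tangle_A B']
  by (auto simp: Hom_def)

lemma braid_inverse:
  assumes "B \<in> tangle_braids n"
  shows "inv_arrow (Tangle n) B \<in> tangle_braids n"
    "inv_arrow (Tangle n) B \<cdot>\<^bsub>Tangle n\<^esub> B = Ident (Tangle n) n"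
    "B \<cdot>\<^bsub>Tangle n\<^esub> inv_arrow (Tangle n) B = Ident (Tangle n) n"
proof -
  obtain B' where B': "B' \<in> braid_composite (Tangle n) Tangle_A" "inverse_arrows (Tangle n) B B'"
    and "B \<in> Arr (Tangle n)"
    using composite_inverse assms tangle_braids_iff by blast
  hence "inv_arrow (Tangle n) B = B'" by (intro T.inv_arrow_eq)
  thus "inv_arrow (Tangle n) B \<in> tangle_braids n"
    "inv_arrow (Tangle n) B \<cdot>\<^bsub>Tangle n\<^esub> B = Ident (Tangle n) n"
    "B \<cdot>\<^bsub>Tangle n\<^esub> inv_arrow (Tangle n) B = Ident (Tangle n) n"
    using B' braid_Hom[OF assms] by (simp_all add: inverse_arrows_iff tangle_braids_iff)
qed

lemma R_Hom': "Tangle_R n \<in> Hom (Tangle n) 0 n" and S_Hom': "Tangle_S n \<in> Hom (Tangle n) n 0"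
  using T.R_Hom T.S_Hom tens_power_Tangle by simp_all

text \<open>By freeness, the generators \<open>R\<close> and \<open>S\<close> may be replaced by any arrows of the same type.\<close>

lemma substitution:
  assumes R': "R' \<in> Hom (Tangle n) 0 n" and S': "S' \<in> Hom (Tangle n) n 0"
    and B: "B \<in> tangle_braids n" and B': "B' \<in> tangle_braids n" and eq: "blocked n B = blocked n B'"
  shows "S' \<cdot>\<^bsub>Tangle n\<^esub> B \<cdot>\<^bsub>Tangle n\<^esub> R' = S' \<cdot>\<^bsub>Tangle n\<^esub> B' \<cdot>\<^bsub>Tangle n\<^esub> R'"
proof -
  interpret U: tangle_algebra_with_blocks "Tangle n" Tangle_A "Tangle_eta n" "Tangle_eps n" n R' S'
    using R' S' tens_power_Tangle by unfold_locales simp_all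
  obtain Fo Fa where F: "U.interprets Fo Fa" using U.Tangle_free_existence by blast
  hence sf: "strict_braided_functor (Tangle n) (Tangle n) Fo Fa" and 1: "Fo 1 = 1"
    and RS: "Fa (Tangle_R n) = R'" "Fa (Tangle_S n) = S'"
    by (auto simp: U.interprets_def)
  have add: "Fo (a + b) = Fo a + Fo b" and zero: "Fo 0 = 0"
    and tw: "Fa (tclass n (TTwist a b)) = tclass n (TTwist (Fo a) (Fo b))"
    and idn: "Fa (tclass n (TId a)) = tclass n (TId (Fo a))" for a b
    using sf by (simp_all add: strict_braided_functor_def)
  have hom: "Fa X \<in> Hom (Tangle n) (Fo (Dom (Tangle n) X)) (Fo (Cod (Tangle n) X))"
    if "X \<in> Arr (Tangle n)" for X
    using sf that by (simp add: strict_braided_functor_def)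
  have comp: "Fa (X \<cdot>\<^bsub>Tangle n\<^esub> Y) = Fa X \<cdot>\<^bsub>Tangle n\<^esub> Fa Y"
    if "X \<in> Hom (Tangle n) b c" "Y \<in> Hom (Tangle n) a b" for X Y a b c
    using sf that by (auto simp: strict_braided_functor_def Hom_def)
  have tens_eq: "Fa (X \<boxtimes>\<^bsub>Tangle n\<^esub> Y) = Fa X \<boxtimes>\<^bsub>Tangle n\<^esub> Fa Y"
    if "X \<in> Arr (Tangle n)" "Y \<in> Arr (Tangle n)" for X Y
    using sf that by (simp add: strict_braided_functor_def)
  have o: "Fo k = k" for k
  proof (induction k)
    case (Suc k) thus ?case using add[of 1 k] 1 by (simp only: Suc_eq_plus1_left)
  qed (simp add: zero)
  have layer: "Fa X = X" if "X \<in> braid_layer (Tangle n) Tangle_A" for X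
    using that
  proof (induction rule: braid_layer.induct)
    case twist_inv
    let ?t = "tclass n (TTwist 1 1)" and ?i = "tclass n (TTwistInv 1 1)"
    have t: "?t \<in> Hom (Tangle n) 2 2" and i: "?i \<in> Hom (Tangle n) 2 2"
      by (auto intro: tclass_Hom)
    have it: "?i \<cdot>\<^bsub>Tangle n\<^esub> ?t = tclass n (TId 2)"
      and ti: "?t \<cdot>\<^bsub>Tangle n\<^esub> ?i = tclass n (TId 2)"
      using inverse_TTwist[of n 1 1] t by (simp_all add: inverse_arrows_iff[OF t])
    have "Fa ?i \<cdot>\<^bsub>Tangle n\<^esub> ?t = tclass n (TId 2)" "?t \<cdot>\<^bsub>Tangle n\<^esub> Fa ?i = tclass n (TId 2)"
      using comp[OF i t] comp[OF t i] unfolding it ti tw idn o by simp_all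
    moreover have "Fa ?i \<in> Hom (Tangle n) 2 2"
      using hom[of ?i] i by (simp add: o Hom_def)
    ultimately have "inverse_arrows (Tangle n) ?t (Fa ?i)"
      by (simp add: inverse_arrows_iff[OF t])
    hence "Fa ?i = ?i" using T.inv_arrow_eq t inv_TTwist[of 1 1] by (fastforce simp: Hom_def)
    thus ?case by (simp only: Tangle_simps inv_TTwist)
  next
    case (tens f g)
    thus ?case using layer_inverse tens_eq by simp
  qed (simp_all add: tw idn o)
  have fix_comp: "Fa X = X" if "X \<in> braid_composite (Tangle n) Tangle_A" for X
    using that
  proof (induction rule: braid_composite.induct)
    case (comp f g)
    have "f \<in> Arr (Tangle n)" "g \<in> Arr (Tangle n)" using composite_inverse comp.hyps by blast+
    hence "Fa (f \<cdot>\<^bsub>Tangle n\<^esub> g) = Fa f \<cdot>\<^bsub>Tangle n\<^esub> Fa g"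
      using sf comp.hyps(3) by (simp add: strict_braided_functor_def)
    thus ?case using comp.IH by simp
  qed (rule layer)
  have "Fa (blocked n X) = S' \<cdot>\<^bsub>Tangle n\<^esub> X \<cdot>\<^bsub>Tangle n\<^esub> R'" if X: "X \<in> tangle_braids n" for X
    unfolding blocked_def
    using comp[OF T.Comp_Hom[OF S_Hom' braid_Hom[OF X]] R_Hom'] comp[OF S_Hom' braid_Hom[OF X]]
      RS fix_comp X by (simp add: tangle_braids_iff)
  from this[OF B] this[OF B'] eq show ?thesis by simp
qed

lemma blocked_comp:
  assumes "B \<in> tangle_braids n" "C \<in> tangle_braids n"
  shows "blocked n (B \<cdot>\<^bsub>Tangle n\<^esub> C) = Tangle_S n \<cdot>\<^bsub>Tangle n\<^esub> B \<cdot>\<^bsub>Tangle n\<^esub> (C \<cdot>\<^bsub>Tangle n\<^esub> Tangle_R n)"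
    "blocked n (B \<cdot>\<^bsub>Tangle n\<^esub> C) = (Tangle_S n \<cdot>\<^bsub>Tangle n\<^esub> B) \<cdot>\<^bsub>Tangle n\<^esub> C \<cdot>\<^bsub>Tangle n\<^esub> Tangle_R n"
proof -
  note h = S_Hom' R_Hom' assms[THEN braid_Hom]
  show "blocked n (B \<cdot>\<^bsub>Tangle n\<^esub> C) = (Tangle_S n \<cdot>\<^bsub>Tangle n\<^esub> B) \<cdot>\<^bsub>Tangle n\<^esub> C \<cdot>\<^bsub>Tangle n\<^esub> Tangle_R n"
    unfolding blocked_def using T.Comp_assoc[OF h(1,3,4)] by simp
  also have "\<dots> = Tangle_S n \<cdot>\<^bsub>Tangle n\<^esub> B \<cdot>\<^bsub>Tangle n\<^esub> (C \<cdot>\<^bsub>Tangle n\<^esub> Tangle_R n)"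
    by (rule T.Comp_assoc[OF T.Comp_Hom[OF h(1,3)] h(4,2)])
  finally show "blocked n (B \<cdot>\<^bsub>Tangle n\<^esub> C) = \<dots>" .
qed

lemma blocked_comp_cong:
  assumes "B \<in> tangle_braids n" "B1 \<in> tangle_braids n" "C \<in> tangle_braids n" "C1 \<in> tangle_braids n"
    and "blocked n B = blocked n B1" "blocked n C = blocked n C1"
  shows "blocked n (B \<cdot>\<^bsub>Tangle n\<^esub> C) = blocked n (B1 \<cdot>\<^bsub>Tangle n\<^esub> C1)"
proof -
  have "blocked n (B \<cdot>\<^bsub>Tangle n\<^esub> C) = blocked n (B1 \<cdot>\<^bsub>Tangle n\<^esub> C)"
    unfolding blocked_comp(1)[OF assms(1,3)] blocked_comp(1)[OF assms(2,3)]
    by (rule substitution[OF T.Comp_Hom[OF braid_Hom[OF assms(3)] R_Hom'] S_Hom' assms(1,2,5)])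
  also have "\<dots> = blocked n (B1 \<cdot>\<^bsub>Tangle n\<^esub> C1)"
    unfolding blocked_comp(2)[OF assms(2,3)] blocked_comp(2)[OF assms(2,4)]
    by (rule substitution[OF R_Hom' T.Comp_Hom[OF S_Hom' braid_Hom[OF assms(2)]] assms(3,4,6)])
  finally show ?thesis .
qed

theorem BB_mult:
  assumes "B \<in> tangle_braids n" "C \<in> tangle_braids n"
  shows "blocked n B \<otimes>\<^bsub>BB n\<^esub> blocked n C = blocked n (B \<cdot>\<^bsub>Tangle n\<^esub> C)"
proof -
  have "(THE z. \<exists>B'\<in>tangle_braids n. \<exists>C'\<in>tangle_braids n. blocked n B = blocked n B' \<and>
      blocked n C = blocked n C' \<and> z = blocked n (B' \<cdot>\<^bsub>Tangle n\<^esub> C')) = blocked n (B \<cdot>\<^bsub>Tangle n\<^esub> C)"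
  proof (rule the_equality)
    show "\<exists>B'\<in>tangle_braids n. \<exists>C'\<in>tangle_braids n. blocked n B = blocked n B' \<and>
      blocked n C = blocked n C' \<and> blocked n (B \<cdot>\<^bsub>Tangle n\<^esub> C) = blocked n (B' \<cdot>\<^bsub>Tangle n\<^esub> C')"
      by (intro bexI[OF _ assms(1)] bexI[OF _ assms(2)] conjI HOL.refl)
  next
    fix z
    assume "\<exists>B'\<in>tangle_braids n. \<exists>C'\<in>tangle_braids n. blocked n B = blocked n B' \<and>
      blocked n C = blocked n C' \<and> z = blocked n (B' \<cdot>\<^bsub>Tangle n\<^esub> C')"
    then obtain B' C' where *: "B' \<in> tangle_braids n" "C' \<in> tangle_braids n"
      "blocked n B = blocked n B'" "blocked n C = blocked n C'"
      and z: "z = blocked n (B' \<cdot>\<^bsub>Tangle n\<^esub> C')" by (elim bexE conjE)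
    show "z = blocked n (B \<cdot>\<^bsub>Tangle n\<^esub> C)"
      unfolding z by (rule blocked_comp_cong[OF assms(1) *(1) assms(2) *(2,3,4), symmetric])
  qed
  thus ?thesis by (simp add: BB_def)
qed

lemma BB_carrier: "carrier (BB n) = blocked n ` tangle_braids n"
  and BB_one: "\<one>\<^bsub>BB n\<^esub> = blocked n (Ident (Tangle n) n)"
  unfolding BB_def tens_power_Tangle by simp_all

theorem BB_group: "group (BB n)"
proof (rule groupI)
  fix x assume "x \<in> carrier (BB n)"
  then obtain B where B: "B \<in> tangle_braids n" "x = blocked n B" by (auto simp: BB_carrier)
  have "blocked n (inv_arrow (Tangle n) B) \<otimes>\<^bsub>BB n\<^esub> x = \<one>\<^bsub>BB n\<^esub>"
    unfolding B(2) BB_one BB_mult[OF braid_inverse(1)[OF B(1)] B(1)] braid_inverse(2)[OF B(1)] ..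
  thus "\<exists>y\<in>carrier (BB n). y \<otimes>\<^bsub>BB n\<^esub> x = \<one>\<^bsub>BB n\<^esub>"
    using braid_inverse(1)[OF B(1)] by (auto simp: BB_carrier)
  show "\<one>\<^bsub>BB n\<^esub> \<otimes>\<^bsub>BB n\<^esub> x = x"
    unfolding B(2) BB_one BB_mult[OF braid_id B(1)] T.Ident_Comp[OF braid_Hom[OF B(1)]] ..
next
  fix x y z assume "x \<in> carrier (BB n)" "y \<in> carrier (BB n)" "z \<in> carrier (BB n)"
  then obtain B C D where *: "B \<in> tangle_braids n" "C \<in> tangle_braids n" "D \<in> tangle_braids n"
    and "x = blocked n B" "y = blocked n C" "z = blocked n D" by (auto simp: BB_carrier)
  thus "x \<otimes>\<^bsub>BB n\<^esub> y \<otimes>\<^bsub>BB n\<^esub> z = x \<otimes>\<^bsub>BB n\<^esub> (y \<otimes>\<^bsub>BB n\<^esub> z)"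
    using T.Comp_assoc[OF *[THEN braid_Hom]] by (simp add: BB_mult braid_comp)
qed (auto simp: BB_carrier BB_one BB_mult braid_comp braid_id simp del: Tangle_simps)

theorem BB_inv:
  assumes "B \<in> tangle_braids n"
  shows "inv\<^bsub>BB n\<^esub> (blocked n B) = blocked n (inv_arrow (Tangle n) B)"
proof -
  interpret group "BB n" by (rule BB_group)
  have "blocked n (inv_arrow (Tangle n) B) \<otimes>\<^bsub>BB n\<^esub> blocked n B = \<one>\<^bsub>BB n\<^esub>"
    unfolding BB_one BB_mult[OF braid_inverse(1)[OF assms] assms] braid_inverse(2)[OF assms] ..
  from inv_equality[OF this] show ?thesis using assms braid_inverse(1) by (simp add: BB_carrier)
qed

end

end

theory Submission
  imports Defs
begin

text \<open>
  For \<open>n > 3\<close> the powers of a single twist of the first two strands are already pairwise distinct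
  blocked braids. They are separated by colouring the strands of a tangle with elements of a group,
  in the style of Wirtinger's presentation of a knot group.

  Fix a group, written additively but not assumed commutative. A tangle with \<open>a\<close> incoming and \<open>b\<close>
  outgoing strands is read as a relation between lists of length \<open>a\<close> and lists of length \<open>b\<close>: when
  two strands coloured \<open>x\<close>, \<open>y\<close> cross, they leave as \<open>y\<close> and the conjugate of \<open>x\<close> by \<open>y\<close>, and a cap
  or a cup joins two strands of opposite colours. Every such relation preserves the ordered sum of
  the colours and commutes with simultaneous conjugation; these two properties are what the
  naturality of the twist needs, and they hold for all tangles as soon as the blocks are interpreted
  by sets of lists of sum \<open>0\<close> closed under conjugation. So the colourings are an invariant of
  arrows (\<open>colour_rel_teq\<close>).

  If the two blocks are the conjugation orbits of lists \<open>u\<close> and \<open>v\<close>, then a closed arrow \<open>SBR\<close> has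
  a colouring iff \<open>B\<close> carries \<open>u\<close> to a list conjugate to \<open>v\<close>. Equal blocked braids therefore move
  every list of sum \<open>0\<close> to conjugate lists (\<open>colour_rel_blocked_eq\<close>), and it suffices to find a list
  whose images under the powers of one braid are pairwise non-conjugate. Let \<open>r\<^sub>i\<close> be the reflection
  \<open>x \<mapsto> i - x\<close> of the integers. A crossing turns \<open>r\<^sub>k, r\<^sub>k\<^sub>+\<^sub>1\<close> into \<open>r\<^sub>k\<^sub>+\<^sub>1, r\<^sub>k\<^sub>+\<^sub>2\<close>, so the \<open>k\<close>-th power of
  the twist sends \<open>r\<^sub>0, r\<^sub>1, r\<^sub>1, r\<^sub>0, 0, \<dots>, 0\<close> to \<open>r\<^sub>k, r\<^sub>k\<^sub>+\<^sub>1, r\<^sub>1, r\<^sub>0, 0, \<dots>, 0\<close>. The third and the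
  fourth strand are untouched, and only the identity commutes with both \<open>r\<^sub>1\<close> and \<open>r\<^sub>0\<close>; hence these
  lists are pairwise non-conjugate. The condition \<open>n > 3\<close> is what leaves room for the two strands that
  pin down the conjugation.
\<close>

section \<open>Conjugation in a group\<close>

definition conj_by :: "'g::group_add \<Rightarrow> 'g \<Rightarrow> 'g" where
  "conj_by g x = - g + x + g"

lemma conj_by_0 [simp]: "conj_by 0 x = x" "conj_by g 0 = 0"
  by (simp_all add: conj_by_def)

lemma conj_by_conj_by: "conj_by h (conj_by g x) = conj_by (g + h) x"
  by (simp only: conj_by_def minus_add add.assoc)

lemma conj_by_minus_conj_by [simp]:
  "conj_by (- g) (conj_by g x) = x" "conj_by g (conj_by (- g) x) = x"
  by (simp_all add: conj_by_conj_by)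

lemma conj_by_add: "conj_by g (x + y) = conj_by g x + conj_by g y"
  by (simp add: conj_by_def add.assoc)

lemma conj_by_uminus: "conj_by g (- x) = - conj_by g x"
  by (simp add: conj_by_def minus_add add.assoc)

lemma sum_list_map_conj_by: "sum_list (map (conj_by g) xs) = conj_by g (sum_list xs)"
  by (induction xs) (simp_all add: conj_by_add)

lemma conj_by_conj_by_swap: "conj_by g (conj_by h x) = conj_by (conj_by g h) (conj_by g x)"
  by (simp add: conj_by_conj_by) (simp add: conj_by_def add.assoc)

text \<open>
  The crossing of two strands with a cap on them admits the same colours as the cap alone:
  the second strand forces the first one to be its inverse, on which it acts trivially.
\<close>

lemma conj_by_eq_minus_iff: "conj_by y x = - y \<longleftrightarrow> x = - y"
  by (metis conj_by_minus_conj_by(1) conj_by_def add.left_neutral add.right_inverse add.assoc left_minus minus_minus)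

lemma conj_by_minus_self: "conj_by (- x) x = x"
  by (simp add: conj_by_def)

section \<open>Tangles as relations between lists of colours\<close>

definition par_rel :: "('g list \<times> 'g list) set \<Rightarrow> ('g list \<times> 'g list) set \<Rightarrow> ('g list \<times> 'g list) set" where
  "par_rel r s = {(xs @ ys, xs' @ ys') | xs xs' ys ys'. (xs, xs') \<in> r \<and> (ys, ys') \<in> s}"

text \<open>
  The strands of the second group pass over those of the first one, all at once; conjugating by
  the sum of \<open>ys\<close> is the effect of crossing them one by one.
\<close>

definition twist_rel :: "nat \<Rightarrow> nat \<Rightarrow> ('g::group_add list \<times> 'g list) set" where
  "twist_rel a b = {(xs @ ys, ys @ map (conj_by (sum_list ys)) xs) | xs ys. length xs = a \<and> length ys = b}"

primrec colour_rel :: "'g::group_add list set \<Rightarrow> 'g list set \<Rightarrow> tangle_term \<Rightarrow> ('g list \<times> 'g list) set" where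
  "colour_rel \<rho> \<sigma> (TId a) = Id_on {xs. length xs = a}"
| "colour_rel \<rho> \<sigma> (TComp f g) = colour_rel \<rho> \<sigma> g O colour_rel \<rho> \<sigma> f"
| "colour_rel \<rho> \<sigma> (TTens f g) = par_rel (colour_rel \<rho> \<sigma> f) (colour_rel \<rho> \<sigma> g)"
| "colour_rel \<rho> \<sigma> (TTwist a b) = twist_rel a b"
| "colour_rel \<rho> \<sigma> (TTwistInv a b) = (twist_rel a b)\<inverse>"
| "colour_rel \<rho> \<sigma> TEta = {([], [x, - x]) | x. True}"
| "colour_rel \<rho> \<sigma> TEps = {([x, - x], []) | x. True}"
| "colour_rel \<rho> \<sigma> TR = {[]} \<times> \<rho>"
| "colour_rel \<rho> \<sigma> TS = \<sigma> \<times> {[]}"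

text \<open>
  The sets of lists that may interpret the blocks: lists of sum \<open>0\<close>, because a block has no strands
  on its other side, and closed under conjugation, because other strands can pass over a block.
\<close>

definition block_colours :: "nat \<Rightarrow> 'g::group_add list set \<Rightarrow> bool" where
  "block_colours n X \<longleftrightarrow>
     (\<forall>xs\<in>X. length xs = n \<and> sum_list xs = 0 \<and> (\<forall>g. map (conj_by g) xs \<in> X))"

lemma par_relI: "\<lbrakk>(xs, xs') \<in> r; (ys, ys') \<in> s\<rbrakk> \<Longrightarrow> (xs @ ys, xs' @ ys') \<in> par_rel r s"
  by (auto simp: par_rel_def)

lemma par_relE:
  assumes "(us, vs) \<in> par_rel r s"
  obtains xs xs' ys ys' where "us = xs @ ys" "vs = xs' @ ys'" "(xs, xs') \<in> r" "(ys, ys') \<in> s"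
  using assms by (auto simp: par_rel_def)

lemma twist_relI:
  "\<lbrakk>length xs = a; length ys = b\<rbrakk> \<Longrightarrow> (xs @ ys, ys @ map (conj_by (sum_list ys)) xs) \<in> twist_rel a b"
  by (auto simp: twist_rel_def)

lemma twist_relE:
  assumes "(us, vs) \<in> twist_rel a b"
  obtains xs ys where "us = xs @ ys" "vs = ys @ map (conj_by (sum_list ys)) xs" "length xs = a" "length ys = b"
  using assms by (auto simp: twist_rel_def)

lemma length_splitE:
  assumes "length xs = a + b"
  obtains us vs where "xs = us @ vs" "length us = a" "length vs = b"
  using assms by (metis append_take_drop_id add_diff_cancel_left' length_drop length_take min_absorb2 le_add1)

lemma par_rel_assoc: "par_rel (par_rel r s) t = par_rel r (par_rel s t)"
  unfolding par_rel_def by (auto) (metis append.assoc)+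

text \<open>
  The lengths at the interface make the splitting of the intermediate list unique.
\<close>

lemma par_rel_relcomp:
  assumes "\<And>xs ys. (xs, ys) \<in> h \<Longrightarrow> length ys = m" "\<And>xs ys. (xs, ys) \<in> f \<Longrightarrow> length xs = m"
  shows "par_rel h k O par_rel f g = par_rel (h O f) (k O g)"
proof (intro subset_antisym subrelI)
  fix us ws assume "(us, ws) \<in> par_rel h k O par_rel f g"
  then obtain vs where "(us, vs) \<in> par_rel h k" "(vs, ws) \<in> par_rel f g" by blast
  thus "(us, ws) \<in> par_rel (h O f) (k O g)"
    by (elim par_relE) (use assms in \<open>auto intro!: par_relI\<close>)
qed (auto elim!: par_relE intro: par_relI)

lemma par_rel_Nil: "par_rel r (Id_on {[]}) = r" "par_rel (Id_on {[]}) r = r"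
  by (auto simp: par_rel_def Id_on_def)

lemma par_rel_Id_on:
  "par_rel (Id_on {xs. length xs = a}) (Id_on {xs. length xs = b}) = Id_on {xs. length xs = a + b}"
  by (auto elim!: par_relE elim: length_splitE intro!: par_relI)

lemma inj_conj_by: "inj (conj_by g)"
  by (metis conj_by_minus_conj_by(1) injI)

lemma twist_rel_relcomp_converse:
  "twist_rel a b O (twist_rel a b)\<inverse> = Id_on {xs. length xs = a + b}"
proof (intro subset_antisym subrelI)
  fix us vs :: "'a list" assume "(us, vs) \<in> twist_rel a b O (twist_rel a b)\<inverse>"
  thus "(us, vs) \<in> Id_on {xs. length xs = a + b}"
    by (auto elim!: twist_relE simp: inj_map_eq_map[OF inj_conj_by])
next
  fix us vs :: "'a list" assume "(us, vs) \<in> Id_on {xs. length xs = a + b}"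
  thus "(us, vs) \<in> twist_rel a b O (twist_rel a b)\<inverse>"
    by (auto elim!: length_splitE intro: twist_relI)
qed

lemma twist_rel_converse_relcomp:
  "(twist_rel a b)\<inverse> O twist_rel a b = Id_on {xs. length xs = b + a}"
proof (intro subset_antisym subrelI)
  fix us vs :: "'a list" assume "(us, vs) \<in> (twist_rel a b)\<inverse> O twist_rel a b"
  thus "(us, vs) \<in> Id_on {xs. length xs = b + a}"
    by (auto elim!: twist_relE)
next
  fix us vs :: "'a list" assume "(us, vs) \<in> Id_on {xs. length xs = b + a}"
  then obtain ys zs where us: "us = ys @ zs" "vs = us" "length ys = b" "length zs = a"
    by (auto elim!: length_splitE)
  have "(map (conj_by (- sum_list ys)) zs @ ys, us) \<in> twist_rel a b"
    using twist_relI[of "map (conj_by (- sum_list ys)) zs" a ys b] us by (simp add: comp_def)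
  thus "(us, vs) \<in> (twist_rel a b)\<inverse> O twist_rel a b" using us(2) by blast
qed

lemma twist_rel_1_1: "twist_rel 1 1 = {([x, y], [y, conj_by y x]) | x y. True}"
proof (intro subset_antisym subrelI)
  fix us vs :: "'a list" assume "(us, vs) \<in> {([x, y], [y, conj_by y x]) | x y. True}"
  then obtain x y where "us = [x] @ [y]" "vs = [y] @ map (conj_by (sum_list [y])) [x]" by auto
  thus "(us, vs) \<in> twist_rel 1 1" by (simp only: twist_relI list.size One_nat_def)
qed (auto elim!: twist_relE simp: length_Suc_conv)

text \<open>
  Crossing two groups of strands in turn conjugates first by the sum of the one, then by the sum of
  the other, which is conjugation by the total sum.
\<close>

lemma twist_rel_add_right:
  "twist_rel a (b + c) =
     par_rel (twist_rel a b) (Id_on {xs. length xs = c}) O par_rel (Id_on {xs. length xs = b}) (twist_rel a c)"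
  (is "_ = ?r O ?s")
proof (intro subset_antisym subrelI)
  fix us vs :: "'a list" assume "(us, vs) \<in> twist_rel a (b + c)"
  then obtain xs ys zs where *: "us = xs @ (ys @ zs)" "length xs = a" "length ys = b" "length zs = c"
    "vs = (ys @ zs) @ map (conj_by (sum_list (ys @ zs))) xs"
    by (elim twist_relE length_splitE) blast
  let ?xs = "map (conj_by (sum_list ys)) xs"
  have "((xs @ ys) @ zs, (ys @ ?xs) @ zs) \<in> ?r"
    using * by (intro par_relI twist_relI) auto
  moreover have "(ys @ (?xs @ zs), ys @ (zs @ map (conj_by (sum_list zs)) ?xs)) \<in> ?s"
    using * by (intro par_relI twist_relI) auto
  ultimately show "(us, vs) \<in> ?r O ?s" unfolding *(1,5) by (auto simp: conj_by_conj_by comp_def)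
next
  fix us vs :: "'a list" assume "(us, vs) \<in> ?r O ?s"
  then obtain ws where "(us, ws) \<in> ?r" "(ws, vs) \<in> ?s" by blast
  then obtain xs ys zs ys' xs' zs' where us: "us = (xs @ ys) @ zs" "length xs = a" "length ys = b" "length zs = c"
    and ws: "ws = (ys @ map (conj_by (sum_list ys)) xs) @ zs" "ws = ys' @ (xs' @ zs')"
      "length ys' = b" "length xs' = a"
    and vs: "vs = ys' @ (zs' @ map (conj_by (sum_list zs')) xs')"
    by (elim par_relE twist_relE Id_onE) (simp only: mem_Collect_eq prod.inject)
  from ws us have "ys' = ys" "xs' = map (conj_by (sum_list ys)) xs" "zs' = zs" by simp_all
  hence "us = xs @ (ys @ zs)" "vs = (ys @ zs) @ map (conj_by (sum_list (ys @ zs))) xs"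
    by (simp_all add: us vs conj_by_conj_by comp_def)
  thus "(us, vs) \<in> twist_rel a (b + c)"
    using twist_relI[of xs a "ys @ zs" "b + c"] us by simp
qed

lemma twist_rel_add_left:
  "twist_rel (a + b) c =
     par_rel (Id_on {xs. length xs = a}) (twist_rel b c) O par_rel (twist_rel a c) (Id_on {xs. length xs = b})"
  (is "_ = ?r O ?s")
proof (intro subset_antisym subrelI)
  fix us vs :: "'a list" assume "(us, vs) \<in> twist_rel (a + b) c"
  then obtain xs ys zs where *: "us = (xs @ ys) @ zs" "length xs = a" "length ys = b" "length zs = c"
    "vs = zs @ map (conj_by (sum_list zs)) (xs @ ys)"
    by (elim twist_relE length_splitE) blast
  let ?ys = "map (conj_by (sum_list zs)) ys"
  have "(xs @ (ys @ zs), xs @ (zs @ ?ys)) \<in> ?r"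
    using * by (intro par_relI twist_relI) auto
  moreover have "((xs @ zs) @ ?ys, (zs @ map (conj_by (sum_list zs)) xs) @ ?ys) \<in> ?s"
    using * by (intro par_relI twist_relI) auto
  ultimately show "(us, vs) \<in> ?r O ?s" unfolding *(1,5) by auto
next
  fix us vs :: "'a list" assume "(us, vs) \<in> ?r O ?s"
  then obtain ws where "(us, ws) \<in> ?r" "(ws, vs) \<in> ?s" by blast
  then obtain xs ys zs ys' xs' zs' where us: "us = xs @ (ys @ zs)" "length xs = a" "length ys = b" "length zs = c"
    and ws: "ws = xs @ (zs @ map (conj_by (sum_list zs)) ys)" "ws = (xs' @ zs') @ ys'"
      "length xs' = a" "length zs' = c"
    and vs: "vs = (zs' @ map (conj_by (sum_list zs')) xs') @ ys'"
    by (elim par_relE twist_relE Id_onE) (simp only: mem_Collect_eq prod.inject)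
  from ws us have "xs' = xs" "ys' = map (conj_by (sum_list zs)) ys" "zs' = zs" by simp_all
  thus "(us, vs) \<in> twist_rel (a + b) c"
    using twist_relI[of "xs @ ys" "a + b" zs c] us vs by simp
qed

text \<open>
  Straightening a strand inverts its colour twice.
\<close>

lemma zigzag_rel:
  fixes cup cap :: "('g::group_add list \<times> 'g list) set"
  defines "cup \<equiv> {([], [x, - x]) | x. True}" and "cap \<equiv> {([x, - x], []) | x. True}"
  shows "par_rel (Id_on {xs. length xs = 1}) cup O par_rel cap (Id_on {xs. length xs = 1}) =
      Id_on {xs. length xs = 1}"
    and "par_rel cup (Id_on {xs. length xs = 1}) O par_rel (Id_on {xs. length xs = 1}) cap =
      Id_on {xs. length xs = 1}"
proof -
  have one: "Id_on {xs. length xs = 1} = {([x], [x]) | x :: 'g. True}"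
    by (auto simp: length_Suc_conv)
  have "par_rel {([x], [x]) | x. True} cup = {([x], [x, y, - y]) | x y. True}"
    "par_rel cap {([x], [x]) | x. True} = {([x, - x, y], [y]) | x y. True}"
    "par_rel cup {([x], [x]) | x. True} = {([x], [y, - y, x]) | x y. True}"
    "par_rel {([x], [x]) | x. True} cap = {([y, x, - x], [y]) | x y. True}"
    by (force simp: par_rel_def cup_def cap_def)+
  thus "par_rel (Id_on {xs. length xs = 1}) cup O par_rel cap (Id_on {xs. length xs = 1}) =
      Id_on {xs. length xs = 1}"
    and "par_rel cup (Id_on {xs. length xs = 1}) O par_rel (Id_on {xs. length xs = 1}) cap =
      Id_on {xs. length xs = 1}"
    unfolding one by (auto simp: relcomp_unfold) (metis minus_minus)+
qed

lemma twist_rel_cap: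
  "twist_rel 1 1 O {([x, - x], []) | x. True} =
     ({([x, - x], []) | x. True} :: ('g::group_add list \<times> 'g list) set)"
proof (intro subset_antisym subrelI)
  fix us vs :: "'g list" assume "(us, vs) \<in> twist_rel 1 1 O {([x, - x], []) | x. True}"
  then obtain x y where *: "us = [x, y]" "conj_by y x = - y" "vs = []"
    unfolding twist_rel_1_1 by auto
  hence "us = [x, - x]" by (simp add: conj_by_eq_minus_iff)
  thus "(us, vs) \<in> {([x, - x], []) | x. True}" using *(3) by blast
next
  fix us vs :: "'g list" assume "(us, vs) \<in> {([x, - x], []) | x. True}"
  then obtain x where x: "us = [x, - x]" "vs = []" by blast
  have "(us, [- x, - (- x)]) \<in> twist_rel 1 1"
    unfolding twist_rel_1_1 x by (simp add: conj_by_minus_self)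
  thus "(us, vs) \<in> twist_rel 1 1 O {([x, - x], []) | x. True}" unfolding x by blast
qed

lemma twist_rel_cup:
  "{([], [x, - x]) | x. True} O twist_rel 1 1 =
     ({([], [x, - x]) | x. True} :: ('g::group_add list \<times> 'g list) set)"
proof (intro subset_antisym subrelI)
  fix us vs :: "'g list" assume "(us, vs) \<in> {([], [x, - x]) | x. True} O twist_rel 1 1"
  then obtain x where "us = []" "vs = [- x, conj_by (- x) x]"
    unfolding twist_rel_1_1 by blast
  hence "us = []" "vs = [- x, - (- x)]" by (simp_all add: conj_by_minus_self)
  thus "(us, vs) \<in> {([], [x, - x]) | x. True}" by blast
next
  fix us vs :: "'g list" assume "(us, vs) \<in> {([], [x, - x]) | x. True}"
  then obtain x where x: "us = []" "vs = [x, - x]" by blast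
  have "([- x, - (- x)], vs) \<in> twist_rel 1 1"
    unfolding twist_rel_1_1 x by (simp add: conj_by_def)
  thus "(us, vs) \<in> {([], [x, - x]) | x. True} O twist_rel 1 1" unfolding x by blast
qed

section \<open>Invariance of the colourings\<close>

lemma colour_rel_typed:
  assumes "block_colours n \<rho>" "block_colours n \<sigma>"
  shows "\<lbrakk>twf n f; (xs, ys) \<in> colour_rel \<rho> \<sigma> f\<rbrakk> \<Longrightarrow>
    length xs = tdom n f \<and> length ys = tcod n f \<and> sum_list xs = sum_list ys"
proof (induction f arbitrary: xs ys)
  case (TComp f g) thus ?case by fastforce
next
  case (TTens f g) thus ?case by (fastforce elim!: par_relE)
next
  case (TTwist a b) thus ?case
    by (auto elim!: twist_relE simp: sum_list_map_conj_by) (simp add: conj_by_def add.assoc)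
next
  case (TTwistInv a b) thus ?case
    by (auto elim!: twist_relE simp: sum_list_map_conj_by) (simp add: conj_by_def add.assoc)
qed (use assms in \<open>auto simp: block_colours_def\<close>)

text \<open>
  Conjugation by a fixed element is an automorphism of the group. The colours at crossings, caps and
  cups are related in terms of the group alone; those at the blocks are closed under conjugation.
\<close>

lemma colour_rel_conj_by:
  assumes "block_colours n \<rho>" "block_colours n \<sigma>"
  shows "(xs, ys) \<in> colour_rel \<rho> \<sigma> f \<Longrightarrow> (map (conj_by g) xs, map (conj_by g) ys) \<in> colour_rel \<rho> \<sigma> f"
proof -
  have twist: "(map (conj_by g) xs, map (conj_by g) ys) \<in> twist_rel a b"
    if "(xs, ys) \<in> twist_rel a b" for a b and xs ys :: "'a list"
    using that
  proof (elim twist_relE)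
    fix us vs assume *: "xs = us @ vs" "ys = vs @ map (conj_by (sum_list vs)) us" "length us = a" "length vs = b"
    show ?thesis
      using twist_relI[of "map (conj_by g) us" a "map (conj_by g) vs" b] *
      by (simp add: sum_list_map_conj_by comp_def conj_by_conj_by_swap[of g "sum_list vs"])
  qed
  show "(xs, ys) \<in> colour_rel \<rho> \<sigma> f \<Longrightarrow> (map (conj_by g) xs, map (conj_by g) ys) \<in> colour_rel \<rho> \<sigma> f"
  proof (induction f arbitrary: xs ys)
    case (TTens f g) thus ?case by (auto elim!: par_relE intro!: par_relI)
  next
    case (TComp f g) thus ?case by (auto intro!: relcompI)
  next
    case (TTwist a b) thus ?case using twist by simp
  next
    case (TTwistInv a b) thus ?case using twist by simp
  qed (use assms in \<open>auto simp: block_colours_def conj_by_uminus\<close>)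
qed

text \<open>
  Sliding the tangles \<open>F\<close> and \<open>G\<close> through a crossing. The colours of the strands of \<open>F\<close> get conjugated
  by the sum of those of \<open>G\<close>. That sum is the same before and after \<open>G\<close>, and the relation \<open>F\<close> does
  not see a conjugation.
\<close>

lemma twist_rel_natural:
  assumes F: "\<And>xs ys. (xs, ys) \<in> F \<Longrightarrow> length xs = a \<and> length ys = a'"
      "\<And>g xs ys. (xs, ys) \<in> F \<Longrightarrow> (map (conj_by g) xs, map (conj_by g) ys) \<in> F"
    and G: "\<And>xs ys. (xs, ys) \<in> G \<Longrightarrow> length xs = b \<and> length ys = b' \<and> sum_list xs = sum_list ys"
  shows "par_rel F G O twist_rel a' b' = twist_rel a b O par_rel G F"
proof (intro subset_antisym subrelI)
  fix us vs assume "(us, vs) \<in> par_rel F G O twist_rel a' b'"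
  then obtain ws where "(us, ws) \<in> par_rel F G" "(ws, vs) \<in> twist_rel a' b'" by blast
  then obtain xs xs' ys ys' xs1 ys1 where us: "us = xs @ ys" "ws = xs' @ ys'" "(xs, xs') \<in> F" "(ys, ys') \<in> G"
    and *: "ws = xs1 @ ys1" "vs = ys1 @ map (conj_by (sum_list ys1)) xs1" "length xs1 = a'"
    by (elim par_relE twist_relE) (simp only:)
  with F(1)[OF us(3)] have eq: "xs1 = xs'" "ys1 = ys'" by simp_all
  have "(us, ys @ map (conj_by (sum_list ys)) xs) \<in> twist_rel a b"
    unfolding us(1) using F(1)[OF us(3)] G[OF us(4)] by (intro twist_relI) simp_all
  moreover have "(ys @ map (conj_by (sum_list ys)) xs, vs) \<in> par_rel G F"
    unfolding *(2) eq using F(2)[OF us(3)] G[OF us(4)] us(4) by (intro par_relI) simp_all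
  ultimately show "(us, vs) \<in> twist_rel a b O par_rel G F" by blast
next
  fix us vs assume "(us, vs) \<in> twist_rel a b O par_rel G F"
  then obtain ws where "(us, ws) \<in> twist_rel a b" "(ws, vs) \<in> par_rel G F" by blast
  then obtain xs ys zs xs' ys1 ys' where us: "us = xs @ ys" "ws = ys @ map (conj_by (sum_list ys)) xs" "length ys = b"
    and *: "ws = ys1 @ zs" "vs = ys' @ xs'" "(zs, xs') \<in> F" "(ys1, ys') \<in> G"
    by (elim par_relE twist_relE) (simp only:)
  with G[OF *(4)] have eq: "ys1 = ys" "zs = map (conj_by (sum_list ys)) xs" by simp_all
  let ?xs = "map (conj_by (- sum_list ys)) xs'"
  have "(xs, ?xs) \<in> F" using F(2)[OF *(3), of "- sum_list ys"] by (simp add: eq comp_def)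
  hence 1: "(us, ?xs @ ys') \<in> par_rel F G" unfolding us using *(4) eq by (intro par_relI) simp_all
  have "(?xs @ ys', ys' @ map (conj_by (sum_list ys')) ?xs) \<in> twist_rel a' b'"
    using F(1)[OF *(3)] G[OF *(4)] by (intro twist_relI) simp_all
  moreover have "vs = ys' @ map (conj_by (sum_list ys')) ?xs"
    using G[OF *(4)] by (simp add: *(2) eq comp_def)
  ultimately show "(us, vs) \<in> par_rel F G O twist_rel a' b'" using 1 by blast
qed

text \<open>
  Soundness of the colourings for the equations of \<open>Tangle n\<close>. Preservation of the sum and
  invariance under conjugation make the crossings natural; the known lengths give the unit laws and
  the interchange law.
\<close>

lemma colour_rel_teq:
  assumes blocks: "block_colours n \<rho>" "block_colours n \<sigma>"
  shows "teq n f g \<Longrightarrow> colour_rel \<rho> \<sigma> f = colour_rel \<rho> \<sigma> g"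
proof (induction rule: teq.induct)
  case (comp_id f)
  thus ?case using colour_rel_typed[OF blocks, of f] by auto
next
  case (id_comp f)
  thus ?case using colour_rel_typed[OF blocks, of f] by auto
next
  case (comp_assoc f g h) show ?case by (simp add: O_assoc)
next
  case (tens_comp f g h k)
  show ?case unfolding colour_rel.simps
    by (rule par_rel_relcomp[of _ "tcod n h"]) (use colour_rel_typed[OF blocks] tens_comp in metis)+
next
  case (tens_unit f) show ?case by (simp add: par_rel_Nil)
next
  case (unit_tens f) show ?case by (simp add: par_rel_Nil)
next
  case (twist_natural f g)
  show ?case unfolding colour_rel.simps
    using colour_rel_typed[OF blocks] colour_rel_conj_by[OF blocks] twist_natural
    by (intro twist_rel_natural) blast+
next
  case zigzag_right
  show ?case unfolding colour_rel.simps by (rule zigzag_rel)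
next
  case zigzag_left
  show ?case unfolding colour_rel.simps by (rule zigzag_rel)
next
  case eps_twist
  show ?case unfolding colour_rel.simps by (rule twist_rel_cap)
next
  case twist_eta
  show ?case unfolding colour_rel.simps by (rule twist_rel_cup)
next
  case (twist_tens_right a b c)
  show ?case unfolding colour_rel.simps by (rule twist_rel_add_right)
next
  case (twist_tens_left a b c)
  show ?case unfolding colour_rel.simps by (rule twist_rel_add_left)
next
  case (twist_inv_left a b)
  show ?case unfolding colour_rel.simps by (rule twist_rel_relcomp_converse)
next
  case (twist_inv_right a b)
  show ?case unfolding colour_rel.simps by (rule twist_rel_converse_relcomp)
qed (simp_all add: par_rel_Id_on par_rel_assoc)

lemma blocked_tclass:
  assumes "twf n f" "tdom n f = n" "tcod n f = n"
  shows "blocked n (tclass n f) = tclass n (TComp (TComp TS f) TR)"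
  using assms by (simp add: blocked_def Tangle_S_def Tangle_R_def tclass_Comp)

text \<open>
  The blocked braid is a closed arrow, whose relation can only hold between the empty lists; it
  holds iff the braid connects some colouring allowed by \<open>R\<close> with one allowed by \<open>S\<close>. Both sets
  can be varied independently, which is why a mere truth value separates many braids.
\<close>

lemma colour_rel_blocked_eq:
  assumes "twf n f" "tdom n f = n" "tcod n f = n" "twf n g" "tdom n g = n" "tcod n g = n"
    and "blocked n (tclass n f) = blocked n (tclass n g)"
    and "block_colours n \<rho>" "block_colours n \<sigma>"
  shows "(\<exists>xs\<in>\<rho>. \<exists>ys\<in>\<sigma>. (xs, ys) \<in> colour_rel \<rho> \<sigma> f) \<longleftrightarrow> (\<exists>xs\<in>\<rho>. \<exists>ys\<in>\<sigma>. (xs, ys) \<in> colour_rel \<rho> \<sigma> g)"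
proof -
  have "teq n (TComp (TComp TS f) TR) (TComp (TComp TS g) TR)"
    using assms by (simp add: blocked_tclass tclass_eq)
  from colour_rel_teq[OF assms(8,9) this]
  have "([], []) \<in> colour_rel \<rho> \<sigma> (TComp (TComp TS f) TR) \<longleftrightarrow>
        ([], []) \<in> colour_rel \<rho> \<sigma> (TComp (TComp TS g) TR)" by simp
  thus ?thesis by (simp add: relcomp_unfold) blast
qed

definition conj_orbit :: "'g::group_add list \<Rightarrow> 'g list set" where
  "conj_orbit xs = range (\<lambda>g. map (conj_by g) xs)"

lemma block_colours_conj_orbit:
  "\<lbrakk>length xs = n; sum_list xs = 0\<rbrakk> \<Longrightarrow> block_colours n (conj_orbit xs)"
  by (auto simp: block_colours_def conj_orbit_def sum_list_map_conj_by conj_by_conj_by comp_def)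

section \<open>The infinite dihedral group\<close>

text \<open>
  The isometries \<open>x \<mapsto> x + a\<close> and \<open>x \<mapsto> a - x\<close> of the integers, added by composing them.
\<close>

datatype dihedral = Translation int | Reflection int

instantiation dihedral :: group_add
begin

definition "0 = Translation 0"

fun plus_dihedral where
  "Translation a + Translation b = Translation (a + b)"
| "Translation a + Reflection b = Reflection (a + b)"
| "Reflection a + Translation b = Reflection (a - b)"
| "Reflection a + Reflection b = Translation (a - b)"

fun uminus_dihedral where
  "- Translation a = Translation (- a)"
| "- Reflection a = Reflection a"

definition "x - y = x + - y" for x y :: dihedral

instance
proof
  fix a b c :: dihedral
  show "a + b + c = a + (b + c)" by (cases a; cases b; cases c) simp_all
  show "0 + a = a" "a + 0 = a" "- a + a = 0" by (cases a; simp add: zero_dihedral_def)+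
  show "a + - b = a - b" by (simp add: minus_dihedral_def)
qed

end

lemma conj_by_Reflection: "conj_by (Reflection b) (Reflection a) = Reflection (2 * b - a)"
  by (simp add: conj_by_def)

text \<open>
  Conjugation by the translation by \<open>a\<close> turns \<open>Reflection 0\<close> into \<open>Reflection (- 2 * a)\<close>, and
  conjugation by \<open>Reflection a\<close> turns it into \<open>Reflection (2 * a)\<close>; so \<open>a = 0\<close> in both cases. But
  \<open>Reflection 0\<close> moves \<open>Reflection 1\<close>, to \<open>Reflection (- 1)\<close>.
\<close>

lemma fix_two_reflections:
  assumes "conj_by g (Reflection 0) = Reflection 0" "conj_by g (Reflection 1) = Reflection 1"
  shows "g = 0"
  using assms by (cases g) (auto simp: conj_by_def zero_dihedral_def)

section \<open>The powers of a twist of two strands\<close>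

primrec twist_power :: "nat \<Rightarrow> nat \<Rightarrow> tangle_term" where
  "twist_power n 0 = TId n"
| "twist_power n (Suc k) = TComp (TTens (TTwist 1 1) (TId (n - 2))) (twist_power n k)"

lemma twist_power_typed:
  "n \<ge> 2 \<Longrightarrow> twf n (twist_power n k) \<and> tdom n (twist_power n k) = n \<and> tcod n (twist_power n k) = n"
  by (induction k) auto

lemma twist_power_braid:
  assumes "n \<ge> 2"
  shows "tclass n (twist_power n k) \<in> tangle_braids n"
proof -
  let ?T = "Tangle n" and ?t = "TTens (TTwist 1 1) (TId (n - 2))"
  have layer: "tclass n ?t \<in> braid_composite ?T 1"
    using braid_composite.layer[OF braid_layer.tens[OF braid_layer.twist braid_layer.ident[of "n - 2" ?T 1]]]
    by (simp add: tclass_Tens)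
  have "tclass n (twist_power n k) \<in> braid_composite ?T 1"
  proof (induction k)
    case 0 show ?case using braid_composite.layer[OF braid_layer.ident[of n ?T 1]] by simp
  next
    case (Suc k)
    have "tclass n ?t \<cdot>\<^bsub>?T\<^esub> tclass n (twist_power n k) \<in> braid_composite ?T 1"
      using twist_power_typed[OF assms, of k] assms
      by (intro braid_composite.comp layer Suc) (simp add: tclass_Dom tclass_Cod)
    thus ?case using twist_power_typed[OF assms, of k] assms by (simp add: tclass_Comp)
  qed
  moreover have "tclass n (twist_power n k) \<in> Hom ?T n n"
    using twist_power_typed[OF assms] by (intro tclass_Hom) auto
  ultimately show ?thesis by (simp add: tangle_braids_iff)
qed

text \<open>
  The ordered sum is \<open>0\<close>: the first two reflections add up to the translation by \<open>-1\<close>, the other two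
  to the translation by \<open>1\<close>. The strands beyond the fourth carry the identity and not reflections,
  because an odd number of reflections never adds up to \<open>0\<close>.
\<close>

definition reflections :: "nat \<Rightarrow> nat \<Rightarrow> dihedral list" where
  "reflections n k = [Reflection (int k), Reflection (int k + 1), Reflection 1, Reflection 0] @ replicate (n - 4) 0"

lemma par_rel_twist_two:
  "([x, y] @ zs, vs) \<in> par_rel (twist_rel 1 1) (Id_on {xs. length xs = m}) \<longleftrightarrow>
     length zs = m \<and> vs = [y, conj_by y x] @ zs"
proof
  assume "length zs = m \<and> vs = [y, conj_by y x] @ zs"
  moreover have "([x, y], [y, conj_by y x]) \<in> twist_rel 1 1"
    by (auto simp only: twist_rel_1_1)
  ultimately show "([x, y] @ zs, vs) \<in> par_rel (twist_rel 1 1) (Id_on {xs. length xs = m})"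
    by (auto intro!: par_relI simp del: append_Cons)
next
  assume "([x, y] @ zs, vs) \<in> par_rel (twist_rel 1 1) (Id_on {xs. length xs = m})"
  then obtain x' y' us where "[x, y] @ zs = [x', y'] @ us" "vs = [y', conj_by y' x'] @ us" "length us = m"
    unfolding twist_rel_1_1 by (elim par_relE Id_onE) blast
  thus "length zs = m \<and> vs = [y, conj_by y x] @ zs" by simp
qed

lemma colour_rel_twist_power:
  assumes "n > 3"
  shows "(reflections n 0, ys) \<in> colour_rel \<rho> \<sigma> (twist_power n k) \<longleftrightarrow> ys = reflections n k"
proof (induction k arbitrary: ys)
  case 0 show ?case using assms by (auto simp: reflections_def)
next
  case (Suc k)
  define zs where "zs = [Reflection 1, Reflection 0] @ replicate (n - 4) (0 :: dihedral)"
  have k: "reflections n k = [Reflection (int k), Reflection (int k + 1)] @ zs"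
    by (simp add: reflections_def zs_def)
  have Suc_k: "reflections n (Suc k) =
      [Reflection (int k + 1), conj_by (Reflection (int k + 1)) (Reflection (int k))] @ zs"
    by (simp add: reflections_def zs_def conj_by_Reflection)
  have zs: "length zs = n - 2" using assms by (simp add: zs_def)
  have "(reflections n k, ys) \<in> colour_rel \<rho> \<sigma> (TTens (TTwist 1 1) (TId (n - 2))) \<longleftrightarrow>
      ys = reflections n (Suc k)"
    unfolding colour_rel.simps k Suc_k par_rel_twist_two using zs by simp
  thus ?case using Suc by (simp add: relcomp_unfold)
qed

lemma reflections_not_conj:
  assumes "map (conj_by g) (reflections n k) = reflections n m"
  shows "k = m"
proof -
  have "conj_by g (Reflection 0) = Reflection 0" "conj_by g (Reflection 1) = Reflection 1"
    and k: "conj_by g (Reflection (int k)) = Reflection (int m)"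
    using assms by (simp_all add: reflections_def)
  hence "g = 0" by (intro fix_two_reflections)
  thus ?thesis using k by simp
qed

theorem theorem7p1:
  fixes n :: nat
  assumes "n > 3"
  shows "infinite (carrier (BB n))"
proof -
  let ?b = "\<lambda>k. blocked n (tclass n (twist_power n k))"
  have n: "n \<ge> 2" using assms by simp
  have len: "length (reflections n k) = n" for k using assms by (simp add: reflections_def)
  have "sum_list (replicate m 0) = (0::dihedral)" for m by (induction m) simp_all
  hence sum: "sum_list (reflections n k) = 0" for k
    by (simp add: reflections_def zero_dihedral_def)
  have "inj ?b"
  proof (rule injI)
    fix k m assume eq: "?b k = ?b m"
    \<comment> \<open>These blocks let the \<open>m\<close>-th power close up iff it acts on the list like the \<open>k\<close>-th power,
      up to conjugation.\<close>
    let ?\<rho> = "conj_orbit (reflections n 0)" and ?\<sigma> = "conj_orbit (reflections n k)"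
    note blocks = block_colours_conj_orbit[OF len[of 0] sum[of 0]] block_colours_conj_orbit[OF len[of k] sum[of k]]
    have self: "xs \<in> conj_orbit xs" for xs :: "dihedral list"
      unfolding conj_orbit_def by (rule range_eqI[of _ _ 0]) (simp add: map_idI)
    have "(reflections n 0, reflections n k) \<in> colour_rel ?\<rho> ?\<sigma> (twist_power n k)"
      using colour_rel_twist_power[OF assms] by blast
    hence "\<exists>xs\<in>?\<rho>. \<exists>ys\<in>?\<sigma>. (xs, ys) \<in> colour_rel ?\<rho> ?\<sigma> (twist_power n k)"
      using self by blast
    hence "\<exists>xs\<in>?\<rho>. \<exists>ys\<in>?\<sigma>. (xs, ys) \<in> colour_rel ?\<rho> ?\<sigma> (twist_power n m)"
      using colour_rel_blocked_eq[OF _ _ _ _ _ _ eq blocks] twist_power_typed[OF n] by simp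
    then obtain g h where "(map (conj_by g) (reflections n 0), map (conj_by h) (reflections n k))
        \<in> colour_rel ?\<rho> ?\<sigma> (twist_power n m)" unfolding conj_orbit_def by blast
    \<comment> \<open>Conjugating back moves the incoming list to the base point, where the image is known.\<close>
    from colour_rel_conj_by[OF blocks this, of "- g"]
    have "(reflections n 0, map (conj_by (- g)) (map (conj_by h) (reflections n k)))
        \<in> colour_rel ?\<rho> ?\<sigma> (twist_power n m)"
      by (simp add: comp_def)
    hence "map (conj_by (- g)) (map (conj_by h) (reflections n k)) = reflections n m"
      unfolding colour_rel_twist_power[OF assms] .
    hence "map (conj_by (h - g)) (reflections n k) = reflections n m"
      by (simp add: comp_def conj_by_conj_by)
    thus "k = m" by (rule reflections_not_conj)
  qed
  hence "infinite (range ?b)" using finite_imageD by blast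
  moreover have "range ?b \<subseteq> carrier (BB n)"
    using twist_power_braid[OF n] by (auto simp: BB_carrier)
  ultimately show ?thesis using infinite_super by blast
qed

end
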